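(* Consider the closed-loop system described in the context with a physically realizable controller given by the Hamiltonian parameterization $a=J_0R+bJb^{T}J_0/2$, $c=J_2\mathbf{I}^{T}b^{T}J_0$, where $R\in\mathbb{S}_n$ and $b\in\mathbb{R}^{n\times(m_2+p)}$, and suppose $\mathcal{A}$ is Hurwitz. Regard $E$ as a function of $(R,b)\in\mathbb{S}_n\times\mathbb{R}^{n\times(m_2+p)}$. Then $(R,b)$ is a critical point of $E$ (i.e. the Fréchet derivatives of $E$ with respect to $R$ and to $b$ both vanish) if and only if there exists a real antisymmetric matrix $\Phi$ of order $n$ such that $$H_{22}=-\Phi J_0$$ and $$\mathfrak{M}(b)+H_{21}\mathbf{C}^{T}+Q_{21}B\mathbf{D}^{T}+J_0\big(H_{12}^{T}B_2+P_{21}C_0^{T}D_0\big)J_2\mathbf{I}^{T}=0,$$ where $\mathfrak{M}$ is the linear operator on $\mathbb{R}^{n\times(m_2+p)}$ given by $$\mathfrak{M}(X):=\Phi XJ+Q_{22}X\mathbf{D}\mathbf{D}^{T}+J_0P_{22}J_0X\mathbf{I}J_2D_0^{T}D_0J_2\mathbf{I}^{T}.$$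
   Context: Let $n=2\nu$, $m_1=2\mu_1$, $m_2=2\mu_2$, and let $p,p_0$ be positive integers. Plant matrices: $A\in\mathbb{R}^{n\times n}$, $B_1\in\mathbb{R}^{n\times m_1}$, $B_2\in\mathbb{R}^{n\times m_2}$, $C\in\mathbb{R}^{p\times n}$, $D\in\mathbb{R}^{p\times m_1}$, $C_0\in\mathbb{R}^{p_0\times n}$, $D_0\in\mathbb{R}^{p_0\times m_2}$. $J_0,J_1,J_2$ are the canonical real antisymmetric matrices of orders $n,m_1,m_2$ (block diagonal with copies of $\begin{bmatrix}0&1\\-1&0\end{bmatrix}$). $J:=\begin{bmatrix}J_2&0\\0&DJ_1D^{T}\end{bmatrix}$, $\mathbf{I}:=\begin{bmatrix}I_{m_2}\\0\end{bmatrix}\in\mathbb{R}^{(m_2+p)\times m_2}$, and $\mathbb{S}_n$ denotes real symmetric $n\times n$ matrices. Controller matrices $a\in\mathbb{R}^{n\times n}$, $b=[\,b_1\ \ b_2\,]\in\mathbb{R}^{n\times(m_2+p)}$ with $b_1\in\mathbb{R}^{n\times m_2}$, $b_2\in\mathbb{R}^{n\times p}$, and $c\in\mathbb{R}^{m_2\times n}$. Set $B:=[\,B_1\ \ B_2\,]$, $\mathbf{C}:=\begin{bmatrix}0\\ C\end{bmatrix}\in\mathbb{R}^{(m_2+p)\times n}$, $\mathbf{D}:=\begin{bmatrix}0 & I_{m_2}\\ D & 0\end{bmatrix}$. Closed-loop matrices: $\mathcal{A}:=\begin{bmatrix}A & B_2c\\ b\mathbf{C} & a\end{bmatrix}$,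 $\mathcal{B}:=\begin{bmatrix}B\\ b\mathbf{D}\end{bmatrix}$, $\mathcal{C}:=\begin{bmatrix}C_0 & D_0c\end{bmatrix}$. When $\mathcal{A}$ is Hurwitz, $P,Q$ are the unique solutions of $\mathcal{A}P+P\mathcal{A}^{T}+\mathcal{B}\mathcal{B}^{T}=0$, $\mathcal{A}^{T}Q+Q\mathcal{A}+\mathcal{C}^{T}\mathcal{C}=0$; $E:=\mathrm{Tr}(\mathcal{C}P\mathcal{C}^{T})$; $H:=QP$. $H,P,Q$ are partitioned into $n\times n$ blocks $H_{jk},P_{jk},Q_{jk}$, $j,k\in\{1,2\}$. Derivatives are Fréchet derivatives with respect to the Frobenius inner product (for $R$, on the space $\mathbb{S}_n$). *)

theory Defs
  imports Complex_Main "Jordan_Normal_Form.Char_Poly"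
begin

text \<open>Canonical real antisymmetric matrix of order k: block diagonal with copies of
  [[0,1],[-1,0]] (k is assumed even where used).\<close>
definition canonJ :: "nat \<Rightarrow> real mat" where
  "canonJ k = mat k k (\<lambda>(i,j). if even i \<and> j = i + 1 then 1
                               else if odd i \<and> i = j + 1 then -1 else 0)"

definition hcat :: "real mat \<Rightarrow> real mat \<Rightarrow> real mat" where
  "hcat X Y = mat (dim_row X) (dim_col X + dim_col Y)
     (\<lambda>(i,j). if j < dim_col X then X $$ (i,j) else Y $$ (i, j - dim_col X))"

definition vcat :: "real mat \<Rightarrow> real mat \<Rightarrow> real mat" where
  "vcat X Y = mat (dim_row X + dim_row Y) (dim_col X)
     (\<lambda>(i,j). if i < dim_row X then X $$ (i,j) else Y $$ (i - dim_row X, j))"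

definition blockdiag :: "real mat \<Rightarrow> real mat \<Rightarrow> real mat" where
  "blockdiag X Y = vcat (hcat X (0\<^sub>m (dim_row X) (dim_col Y)))
                        (hcat (0\<^sub>m (dim_row Y) (dim_col X)) Y)"

text \<open>The (j,k) block (j,k \<in> {1,2}) of size k0 x k0 of a 2k0 x 2k0 matrix.\<close>
definition blk :: "real mat \<Rightarrow> nat \<Rightarrow> nat \<Rightarrow> nat \<Rightarrow> real mat" where
  "blk X k0 j k = mat k0 k0 (\<lambda>(r,s). X $$ ((j - 1) * k0 + r, (k - 1) * k0 + s))"

definition mtrace :: "real mat \<Rightarrow> real" where
  "mtrace X = (\<Sum>i<dim_row X. X $$ (i,i))"

definition frob :: "real mat \<Rightarrow> real" where
  "frob X = sqrt (\<Sum>i<dim_row X. \<Sum>j<dim_col X. (X $$ (i,j))\<^sup>2)"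

definition hurwitz :: "real mat \<Rightarrow> bool" where
  "hurwitz M \<longleftrightarrow> M \<in> carrier_mat (dim_row M) (dim_row M) \<and>
     (\<forall>k. eigenvalue (map_mat complex_of_real M) k \<longrightarrow> Re k < 0)"

record plant =
  pA :: "real mat"
  pB1 :: "real mat"
  pB2 :: "real mat"
  pC :: "real mat"
  pD :: "real mat"
  pC0 :: "real mat"
  pD0 :: "real mat"

text \<open>Dimensions: n = dim_row A, m1 = dim_col B1, m2 = dim_col B2, p = dim_row C.\<close>

definition J0 :: "plant \<Rightarrow> real mat" where "J0 G = canonJ (dim_row (pA G))"
definition J1 :: "plant \<Rightarrow> real mat" where "J1 G = canonJ (dim_col (pB1 G))"
definition J2 :: "plant \<Rightarrow> real mat" where "J2 G = canonJ (dim_col (pB2 G))"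

definition bigJ :: "plant \<Rightarrow> real mat" where
  "bigJ G = blockdiag (J2 G) (pD G * J1 G * transpose_mat (pD G))"

definition bfI :: "plant \<Rightarrow> real mat" where
  "bfI G = vcat (1\<^sub>m (dim_col (pB2 G))) (0\<^sub>m (dim_row (pC G)) (dim_col (pB2 G)))"

definition bfC :: "plant \<Rightarrow> real mat" where
  "bfC G = vcat (0\<^sub>m (dim_col (pB2 G)) (dim_row (pA G))) (pC G)"

definition bfD :: "plant \<Rightarrow> real mat" where
  "bfD G = vcat (hcat (0\<^sub>m (dim_col (pB2 G)) (dim_col (pB1 G))) (1\<^sub>m (dim_col (pB2 G))))
                (hcat (pD G) (0\<^sub>m (dim_row (pC G)) (dim_col (pB2 G))))"

definition Bcat :: "plant \<Rightarrow> real mat" where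
  "Bcat G = hcat (pB1 G) (pB2 G)"

definition ctrl_a :: "plant \<Rightarrow> real mat \<Rightarrow> real mat \<Rightarrow> real mat" where
  "ctrl_a G R b = J0 G * R + (1/2) \<cdot>\<^sub>m (b * bigJ G * transpose_mat b * J0 G)"

definition ctrl_c :: "plant \<Rightarrow> real mat \<Rightarrow> real mat" where
  "ctrl_c G b = J2 G * transpose_mat (bfI G) * transpose_mat b * J0 G"

definition clA :: "plant \<Rightarrow> real mat \<Rightarrow> real mat \<Rightarrow> real mat" where
  "clA G R b = vcat (hcat (pA G) (pB2 G * ctrl_c G b)) (hcat (b * bfC G) (ctrl_a G R b))"

definition clB :: "plant \<Rightarrow> real mat \<Rightarrow> real mat" where
  "clB G b = vcat (Bcat G) (b * bfD G)"

definition clC :: "plant \<Rightarrow> real mat \<Rightarrow> real mat" where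
  "clC G b = hcat (pC0 G) (pD0 G * ctrl_c G b)"

text \<open>Controllability / observability Gramians (unique solutions when clA is Hurwitz).\<close>
definition gramP :: "plant \<Rightarrow> real mat \<Rightarrow> real mat \<Rightarrow> real mat" where
  "gramP G R b = (THE P. P \<in> carrier_mat (2 * dim_row (pA G)) (2 * dim_row (pA G)) \<and>
      clA G R b * P + P * transpose_mat (clA G R b) + clB G b * transpose_mat (clB G b)
        = 0\<^sub>m (2 * dim_row (pA G)) (2 * dim_row (pA G)))"

definition gramQ :: "plant \<Rightarrow> real mat \<Rightarrow> real mat \<Rightarrow> real mat" where
  "gramQ G R b = (THE Q. Q \<in> carrier_mat (2 * dim_row (pA G)) (2 * dim_row (pA G)) \<and>
      transpose_mat (clA G R b) * Q + Q * clA G R b + transpose_mat (clC G b) * clC G b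
        = 0\<^sub>m (2 * dim_row (pA G)) (2 * dim_row (pA G)))"

definition costE :: "plant \<Rightarrow> real mat \<Rightarrow> real mat \<Rightarrow> real" where
  "costE G R b = mtrace (clC G b * gramP G R b * transpose_mat (clC G b))"

text \<open>Vanishing Fr\'echet derivative of E w.r.t. R (on the space of symmetric matrices,
  Frobenius norm) and w.r.t. b (on R^{n x (m2+p)}), written out via the definition.\<close>
definition dE_R_zero :: "plant \<Rightarrow> real mat \<Rightarrow> real mat \<Rightarrow> bool" where
  "dE_R_zero G R b \<longleftrightarrow> (\<forall>\<epsilon>>0. \<exists>\<delta>>0. \<forall>dR.
     dR \<in> carrier_mat (dim_row (pA G)) (dim_row (pA G)) \<and> transpose_mat dR = dR \<and> frob dR < \<delta>
     \<longrightarrow> \<bar>costE G (R + dR) b - costE G R b\<bar> \<le> \<epsilon> * frob dR)"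

definition dE_b_zero :: "plant \<Rightarrow> real mat \<Rightarrow> real mat \<Rightarrow> bool" where
  "dE_b_zero G R b \<longleftrightarrow> (\<forall>\<epsilon>>0. \<exists>\<delta>>0. \<forall>db.
     db \<in> carrier_mat (dim_row (pA G)) (dim_col (pB2 G) + dim_row (pC G)) \<and> frob db < \<delta>
     \<longrightarrow> \<bar>costE G R (b + db) - costE G R b\<bar> \<le> \<epsilon> * frob db)"

definition opM :: "plant \<Rightarrow> real mat \<Rightarrow> real mat \<Rightarrow> real mat \<Rightarrow> real mat \<Rightarrow> real mat" where
  "opM G R b \<Phi> X = (let n = dim_row (pA G); Q = gramQ G R b; P = gramP G R b in
     \<Phi> * X * bigJ G + blk Q n 2 2 * X * bfD G * transpose_mat (bfD G)
     + J0 G * blk P n 2 2 * J0 G * X * bfI G * J2 G * transpose_mat (pD0 G) * pD0 G * J2 G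
         * transpose_mat (bfI G))"

end

theory Submission
  imports
    Defs
    "Jordan_Normal_Form.Schur_Decomposition"
    "HOL-Library.Landau_Symbols"
    "HOL-Analysis.L2_Norm"
begin

text \<open>
  The cost is the pairing \<open>\<langle>C\<^sup>T C, P\<rangle>\<close> with the solution of a Lyapunov equation. Pairing
  the perturbed equation for \<open>P\<close> with the unperturbed adjoint solution \<open>Q\<close> gives
  \<open>dE = 2 (\<langle>QP, dA\<rangle> + \<langle>QB, dB\<rangle> + \<langle>CP, dC\<rangle>)\<close> with a quadratic remainder. In the direction of
  \<open>R\<close> this is the pairing with \<open>J\<^sub>0\<^sup>T H\<^sub>2\<^sub>2\<close>, which vanishes on symmetric matrices iff that matrix,
  equivalently its congruent \<open>\<Phi> = H\<^sub>2\<^sub>2 J\<^sub>0\<close>, is antisymmetric. In the direction of \<open>b\<close> the term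
  of \<open>a\<close> quadratic in \<open>b\<close> contributes \<open>S b J\<close>, where \<open>S\<close> is the antisymmetric part of \<open>H\<^sub>2\<^sub>2 J\<^sub>0\<close>;
  this is \<open>\<Phi> b J\<close> once \<open>\<Phi>\<close> is antisymmetric.
\<close>

subsection \<open>Matrix arithmetic under dimension hypotheses\<close>

lemma index_mult_mat_sum:
  "i < dim_row A \<Longrightarrow> j < dim_col B \<Longrightarrow> dim_col A = dim_row B \<Longrightarrow>
   (A * B) $$ (i,j) = (\<Sum>k<dim_row B. A $$ (i,k) * B $$ (k,j))"
  by (simp add: scalar_prod_def atLeast0LessThan)

lemma assoc_mult_mat_dim:
  "dim_col A = dim_row B \<Longrightarrow> dim_col B = dim_row C \<Longrightarrow> A * B * C = A * (B * C)"
  for A B C :: "'a::semiring_0 mat"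
  by (rule assoc_mult_mat[of _ "dim_row A" "dim_row B" _ "dim_row C" _ "dim_col C"]) auto

lemma add_mult_distrib_mat_dim:
  "dim_row A = dim_row B \<Longrightarrow> dim_col A = dim_col B \<Longrightarrow> dim_col B = dim_row C \<Longrightarrow>
   (A + B) * C = A * C + B * C" for A B C :: "'a::semiring_0 mat"
  by (rule add_mult_distrib_mat[of _ "dim_row A" "dim_row C" _ _ "dim_col C"]) auto

lemma mult_add_distrib_mat_dim:
  "dim_row B = dim_row C \<Longrightarrow> dim_col B = dim_col C \<Longrightarrow> dim_col A = dim_row C \<Longrightarrow>
   A * (B + C) = A * B + A * C" for A B C :: "'a::semiring_0 mat"
  by (rule mult_add_distrib_mat[of _ "dim_row A" "dim_row C" _ "dim_col C"]) auto

lemma transpose_mult_dim: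
  "dim_col A = dim_row B \<Longrightarrow> (A * B)\<^sup>T = B\<^sup>T * A\<^sup>T" for A B :: "'a::comm_semiring_0 mat"
  by (rule transpose_mult[of _ "dim_row A" "dim_row B" _ "dim_col B"]) auto

lemma transpose_add_dim:
  "dim_row A = dim_row B \<Longrightarrow> dim_col A = dim_col B \<Longrightarrow> (A + B)\<^sup>T = A\<^sup>T + B\<^sup>T"
  by (rule eq_matI) auto

lemma transpose_smult: "(c \<cdot>\<^sub>m A)\<^sup>T = c \<cdot>\<^sub>m A\<^sup>T"
  by (rule eq_matI) auto

lemma smult_mult_dim: "dim_col A = dim_row B \<Longrightarrow> (c \<cdot>\<^sub>m A) * B = c \<cdot>\<^sub>m (A * B)"
  for A B :: "'a::comm_semiring_0 mat"
  by (rule mult_smult_assoc_mat[of _ "dim_row A" "dim_row B" _ "dim_col B"]) auto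

lemma right_add_zero_mat_dim: "dim_row A = r \<Longrightarrow> dim_col A = c \<Longrightarrow> A + 0\<^sub>m r c = A"
  for A :: "'a::monoid_add mat"
  by (rule eq_matI) auto

lemmas mat_dim_simps = assoc_mult_mat_dim add_mult_distrib_mat_dim mult_add_distrib_mat_dim
  transpose_mult_dim transpose_add_dim

lemma add_mat_eq_0_iff:
  "A \<in> carrier_mat r c \<Longrightarrow> B \<in> carrier_mat r c \<Longrightarrow> A + B = 0\<^sub>m r c \<longleftrightarrow> A = - B"
  for A B :: "'a::group_add mat"
  by (auto simp: mat_eq_iff eq_neg_iff_add_eq_0)

subsection \<open>The Frobenius inner product and norm\<close>

definition frob_inner :: "real mat \<Rightarrow> real mat \<Rightarrow> real" (\<open>\<langle>_,/ _\<rangle>\<close>) where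
  "\<langle>X, Y\<rangle> = mtrace (X\<^sup>T * Y)"

lemma mtrace_mult_eq_sum:
  "dim_col A = dim_row B \<Longrightarrow> dim_col B = dim_row A \<Longrightarrow>
   mtrace (A * B) = (\<Sum>i<dim_row A. \<Sum>k<dim_row B. A $$ (i,k) * B $$ (k,i))"
  by (simp add: mtrace_def index_mult_mat_sum del: index_mult_mat(1))

lemma mtrace_mult_commute:
  "dim_col A = dim_row B \<Longrightarrow> dim_col B = dim_row A \<Longrightarrow> mtrace (A * B) = mtrace (B * A)"
  by (simp add: mtrace_mult_eq_sum mult.commute) (rule sum.swap)

lemma frob_inner_eq_sum:
  assumes "dim_row X = dim_row Y" "dim_col X = dim_col Y"
  shows "\<langle>X, Y\<rangle> = (\<Sum>ij\<in>{..<dim_row Y} \<times> {..<dim_col Y}. X $$ ij * Y $$ ij)"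
proof -
  have "\<langle>X, Y\<rangle> = (\<Sum>j<dim_col Y. \<Sum>i<dim_row Y. X $$ (i,j) * Y $$ (i,j))"
    using assms by (simp add: frob_inner_def mtrace_mult_eq_sum)
  also have "\<dots> = (\<Sum>i<dim_row Y. \<Sum>j<dim_col Y. X $$ (i,j) * Y $$ (i,j))"
    by (rule sum.swap)
  finally show ?thesis by (simp add: sum.cartesian_product split_def)
qed

lemma frob_inner_commute:
  "dim_row X = dim_row Y \<Longrightarrow> dim_col X = dim_col Y \<Longrightarrow> \<langle>X, Y\<rangle> = \<langle>Y, X\<rangle>"
  by (simp add: frob_inner_eq_sum mult.commute)

lemma frob_inner_transpose:
  "dim_row X = dim_row Y \<Longrightarrow> dim_col X = dim_col Y \<Longrightarrow> \<langle>X\<^sup>T, Y\<^sup>T\<rangle> = \<langle>X, Y\<rangle>"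
  by (metis frob_inner_commute frob_inner_def index_transpose_mat(2,3) mtrace_mult_commute
      transpose_transpose)

lemma frob_inner_mult_left_adjoint:
  assumes "dim_row X = dim_row A" "dim_col X = dim_col B" "dim_col A = dim_row B"
  shows "\<langle>X, A * B\<rangle> = \<langle>A\<^sup>T * X, B\<rangle>"
  using assms by (simp add: frob_inner_def mat_dim_simps)

lemma frob_inner_mult_right_adjoint:
  assumes "dim_row X = dim_row A" "dim_col X = dim_col B" "dim_col A = dim_row B"
  shows "\<langle>X, A * B\<rangle> = \<langle>X * B\<^sup>T, A\<rangle>"
  using assms mtrace_mult_commute[of "X\<^sup>T * A" B] by (simp add: frob_inner_def mat_dim_simps)

lemma frob_inner_add_left:
  assumes "dim_row X = dim_row Z" "dim_col X = dim_col Z" "dim_row Y = dim_row Z" "dim_col Y = dim_col Z"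
  shows "\<langle>X + Y, Z\<rangle> = \<langle>X, Z\<rangle> + \<langle>Y, Z\<rangle>"
proof -
  have "\<langle>X + Y, Z\<rangle> = (\<Sum>ij\<in>{..<dim_row Z} \<times> {..<dim_col Z}. X $$ ij * Z $$ ij + Y $$ ij * Z $$ ij)"
    using assms by (subst frob_inner_eq_sum, simp, simp, intro sum.cong) (auto simp: distrib_right)
  then show ?thesis
    using assms by (simp only: frob_inner_eq_sum sum.distrib)
qed

lemma frob_inner_add_right:
  "dim_row X = dim_row Z \<Longrightarrow> dim_col X = dim_col Z \<Longrightarrow> dim_row Y = dim_row Z \<Longrightarrow> dim_col Y = dim_col Z \<Longrightarrow>
   \<langle>Z, X + Y\<rangle> = \<langle>Z, X\<rangle> + \<langle>Z, Y\<rangle>"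
  by (metis frob_inner_add_left frob_inner_commute index_add_mat(2,3))

lemma frob_inner_uminus_left:
  "dim_row X = dim_row Y \<Longrightarrow> dim_col X = dim_col Y \<Longrightarrow> \<langle>- X, Y\<rangle> = - \<langle>X, Y\<rangle>"
  by (simp add: frob_inner_eq_sum sum_negf[symmetric]) (rule sum.cong; auto)

lemma frob_inner_smult_left:
  "dim_row X = dim_row Y \<Longrightarrow> dim_col X = dim_col Y \<Longrightarrow> \<langle>c \<cdot>\<^sub>m X, Y\<rangle> = c * \<langle>X, Y\<rangle>"
  by (simp add: frob_inner_eq_sum sum_distrib_left) (rule sum.cong; auto)

lemma frob_inner_smult_right:
  "dim_row X = dim_row Y \<Longrightarrow> dim_col X = dim_col Y \<Longrightarrow> \<langle>X, c \<cdot>\<^sub>m Y\<rangle> = c * \<langle>X, Y\<rangle>"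
  by (metis frob_inner_commute frob_inner_smult_left index_smult_mat(2,3))

lemma frob_inner_zero_left: "\<langle>0\<^sub>m (dim_row X) (dim_col X), X\<rangle> = 0"
  by (subst frob_inner_eq_sum) (auto intro: sum.neutral)

lemma frob_inner_zero_right: "\<langle>X, 0\<^sub>m (dim_row X) (dim_col X)\<rangle> = 0"
  by (subst frob_inner_eq_sum) (auto intro: sum.neutral)

lemma frob_eq_L2_set: "frob X = L2_set (($$) X) ({..<dim_row X} \<times> {..<dim_col X})"
  by (simp add: frob_def L2_set_def sum.cartesian_product split_def)

lemma frob_inner_self: "\<langle>X, X\<rangle> = (frob X)\<^sup>2"
  by (simp add: frob_inner_eq_sum frob_eq_L2_set L2_set_def sum_nonneg power2_eq_square)

lemma frob_nonneg [simp]: "0 \<le> frob X"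
  by (simp add: frob_eq_L2_set)

lemma frob_eq_0_iff: "frob X = 0 \<longleftrightarrow> X = 0\<^sub>m (dim_row X) (dim_col X)"
  by (auto simp: frob_eq_L2_set L2_set_eq_0_iff mat_eq_iff)

lemma frob_zero [simp]: "frob (0\<^sub>m r c) = 0"
  by (simp add: frob_eq_0_iff)

lemma frob_smult: "frob (c \<cdot>\<^sub>m X) = \<bar>c\<bar> * frob X"
  by (simp add: frob_def power_mult_distrib sum_distrib_left[symmetric] real_sqrt_mult)

lemma frob_transpose [simp]: "frob X\<^sup>T = frob X"
  by (simp add: frob_def) (rule sum.swap)

lemma frob_uminus [simp]: "frob (- X) = frob X"
  by (simp add: frob_def)

lemma frob_triangle_ineq:
  assumes "dim_row X = dim_row Y" "dim_col X = dim_col Y"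
  shows "frob (X + Y) \<le> frob X + frob Y"
proof -
  have "frob (X + Y) = L2_set (\<lambda>ij. X $$ ij + Y $$ ij) ({..<dim_row Y} \<times> {..<dim_col Y})"
    unfolding frob_eq_L2_set by (rule L2_set_cong) auto
  then show ?thesis
    using assms L2_set_triangle_ineq by (simp add: frob_eq_L2_set)
qed

lemma frob_Cauchy_Schwarz:
  assumes "dim_row X = dim_row Y" "dim_col X = dim_col Y"
  shows "\<bar>\<langle>X, Y\<rangle>\<bar> \<le> frob X * frob Y"
proof -
  have "\<bar>\<langle>X, Y\<rangle>\<bar> \<le> (\<Sum>ij\<in>{..<dim_row Y} \<times> {..<dim_col Y}. \<bar>X $$ ij\<bar> * \<bar>Y $$ ij\<bar>)"
    unfolding frob_inner_eq_sum[OF assms] by (rule order_trans[OF sum_abs]) (simp add: abs_mult)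
  also have "\<dots> \<le> frob X * frob Y"
    using assms L2_set_mult_ineq by (simp add: frob_eq_L2_set)
  finally show ?thesis .
qed

lemma frob_mult_le:
  assumes "dim_col X = dim_row Y"
  shows "frob (X * Y) \<le> frob X * frob Y"
proof -
  let ?r = "\<lambda>i. L2_set (\<lambda>k. X $$ (i,k)) {..<dim_row Y}"
    and ?c = "\<lambda>j. L2_set (\<lambda>k. Y $$ (k,j)) {..<dim_row Y}"
  have "((X * Y) $$ (i,j))\<^sup>2 \<le> (?r i)\<^sup>2 * (?c j)\<^sup>2" if "i < dim_row X" "j < dim_col Y" for i j
  proof -
    have "\<bar>(X * Y) $$ (i,j)\<bar> \<le> (\<Sum>k<dim_row Y. \<bar>X $$ (i,k)\<bar> * \<bar>Y $$ (k,j)\<bar>)"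
      using that assms by (simp add: index_mult_mat_sum abs_mult[symmetric] del: index_mult_mat(1))
    also have "\<dots> \<le> ?r i * ?c j"
      by (rule L2_set_mult_ineq)
    finally show ?thesis
      by (simp add: abs_le_square_iff[symmetric] power_mult_distrib[symmetric])
  qed
  then have "(\<Sum>i<dim_row X. \<Sum>j<dim_col Y. ((X * Y) $$ (i,j))\<^sup>2)
      \<le> (\<Sum>i<dim_row X. \<Sum>j<dim_col Y. (?r i)\<^sup>2 * (?c j)\<^sup>2)"
    by (intro sum_mono) auto
  also have "\<dots> = (\<Sum>i<dim_row X. (?r i)\<^sup>2) * (\<Sum>j<dim_col Y. (?c j)\<^sup>2)"
    by (simp add: sum_product)
  also have "(\<Sum>i<dim_row X. (?r i)\<^sup>2) = (frob X)\<^sup>2"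
    using assms by (simp add: L2_set_def frob_def sum_nonneg)
  also have "(\<Sum>j<dim_col Y. (?c j)\<^sup>2) = (frob Y\<^sup>T)\<^sup>2"
    by (simp add: L2_set_def frob_def sum_nonneg del: frob_transpose)
  finally show ?thesis
    by (simp add: frob_def[of "X * Y"] real_le_lsqrt power_mult_distrib sum_nonneg)
qed

subsection \<open>Asymptotics of matrix-valued functions\<close>

lemma frob_add_bigo:
  assumes "\<forall>\<^sub>F x in F. dim_row (X x) = dim_row (Y x) \<and> dim_col (X x) = dim_col (Y x)"
    and "(\<lambda>x. frob (X x)) \<in> O[F](g)" "(\<lambda>x. frob (Y x)) \<in> O[F](g)"
  shows "(\<lambda>x. frob (X x + Y x)) \<in> O[F](g)"
proof -
  have "(\<lambda>x. frob (X x + Y x)) \<in> O[F](\<lambda>x. frob (X x) + frob (Y x))"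
    using assms(1) by (intro landau_o.big_mono) (auto elim!: eventually_mono intro: frob_triangle_ineq)
  also have "(\<lambda>x. frob (X x) + frob (Y x)) \<in> O[F](g)"
    by (intro sum_in_bigo assms)
  finally show ?thesis .
qed

lemma frob_mult_bigo:
  assumes "\<forall>\<^sub>F x in F. dim_col (X x) = dim_row (Y x)"
    and "(\<lambda>x. frob (X x)) \<in> O[F](f)" "(\<lambda>x. frob (Y x)) \<in> O[F](g)"
  shows "(\<lambda>x. frob (X x * Y x)) \<in> O[F](\<lambda>x. f x * g x)"
proof -
  have "(\<lambda>x. frob (X x * Y x)) \<in> O[F](\<lambda>x. frob (X x) * frob (Y x))"
    using assms(1) by (intro landau_o.big_mono) (auto elim!: eventually_mono intro: frob_mult_le)
  also have "(\<lambda>x. frob (X x) * frob (Y x)) \<in> O[F](\<lambda>x. f x * g x)"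
    by (intro landau_o.big.mult assms)
  finally show ?thesis .
qed

lemma frob_const_mult_bigo:
  assumes "\<forall>\<^sub>F x in F. dim_col A = dim_row (X x)" "(\<lambda>x. frob (X x)) \<in> O[F](g)"
  shows "(\<lambda>x. frob (A * X x)) \<in> O[F](g)"
  using frob_mult_bigo[of "\<lambda>_. A" X F "\<lambda>_. 1" g] assms by simp

lemma frob_mult_const_bigo:
  assumes "\<forall>\<^sub>F x in F. dim_col (X x) = dim_row A" "(\<lambda>x. frob (X x)) \<in> O[F](g)"
  shows "(\<lambda>x. frob (X x * A)) \<in> O[F](g)"
  using frob_mult_bigo[of X "\<lambda>_. A" F g "\<lambda>_. 1"] assms by simp

lemma frob_inner_bigo:
  assumes "\<forall>\<^sub>F x in F. dim_row (X x) = dim_row (Y x) \<and> dim_col (X x) = dim_col (Y x)"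
    and "(\<lambda>x. frob (X x)) \<in> O[F](f)" "(\<lambda>x. frob (Y x)) \<in> O[F](g)"
  shows "(\<lambda>x. \<langle>X x, Y x\<rangle>) \<in> O[F](\<lambda>x. f x * g x)"
proof -
  have "(\<lambda>x. \<langle>X x, Y x\<rangle>) \<in> O[F](\<lambda>x. frob (X x) * frob (Y x))"
    using assms(1) by (intro landau_o.big_mono) (auto elim!: eventually_mono intro: frob_Cauchy_Schwarz)
  also have "(\<lambda>x. frob (X x) * frob (Y x)) \<in> O[F](\<lambda>x. f x * g x)"
    by (intro landau_o.big.mult assms)
  finally show ?thesis .
qed

definition near_zero :: "real mat set \<Rightarrow> real mat filter" where
  "near_zero S = inf (filtercomap frob (nhds 0)) (principal S)"

lemma eventually_near_zero:
  "(\<forall>\<^sub>F X in near_zero S. P X) \<longleftrightarrow> (\<exists>\<delta>>0. \<forall>X\<in>S. frob X < \<delta> \<longrightarrow> P X)"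
  unfolding near_zero_def eventually_inf_principal eventually_filtercomap eventually_nhds_metric
  by (auto simp: dist_real_def)

lemma eventually_near_zero_in: "\<forall>\<^sub>F X in near_zero S. X \<in> S"
  by (auto simp: eventually_near_zero intro: exI[of _ 1])

lemma frob_tendsto_near_zero: "(frob \<longlongrightarrow> 0) (near_zero S)"
  unfolding near_zero_def by (rule tendsto_mono[OF inf_le1 filterlim_filtercomap])

lemma smallo_near_zero_iff:
  "f \<in> o[near_zero S](frob) \<longleftrightarrow>
   (\<forall>\<epsilon>>0. \<exists>\<delta>>0. \<forall>X\<in>S. frob X < \<delta> \<longrightarrow> \<bar>f X\<bar> \<le> \<epsilon> * frob X)"
  by (simp add: smallo_def eventually_near_zero)

lemma frob_inner_smallo_iff:
  assumes S: "S \<subseteq> carrier_mat (dim_row D) (dim_col D)"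
    and cone: "\<And>t X. X \<in> S \<Longrightarrow> t \<cdot>\<^sub>m X \<in> S"
  shows "(\<lambda>X. \<langle>D, X\<rangle>) \<in> o[near_zero S](frob) \<longleftrightarrow> (\<forall>X\<in>S. \<langle>D, X\<rangle> = 0)"
proof (intro iffI ballI)
  fix X assume small: "(\<lambda>X. \<langle>D, X\<rangle>) \<in> o[near_zero S](frob)" and X: "X \<in> S"
  show "\<langle>D, X\<rangle> = 0"
  proof (rule ccontr)
    assume "\<langle>D, X\<rangle> \<noteq> 0"
    define N where "N = frob X + 1"
    have N: "N > 0" by (simp add: N_def add_nonneg_pos)
    then have "\<bar>\<langle>D, X\<rangle>\<bar> / N > 0" using \<open>\<langle>D, X\<rangle> \<noteq> 0\<close> by simp
    then obtain \<delta> where \<delta>: "\<delta> > 0" "\<And>Y. Y \<in> S \<Longrightarrow> frob Y < \<delta> \<Longrightarrow> \<bar>\<langle>D, Y\<rangle>\<bar> \<le> \<bar>\<langle>D, X\<rangle>\<bar> / N * frob Y"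
      using small unfolding smallo_near_zero_iff by blast
    define t where "t = \<delta> / N"
    have t: "t > 0" using \<delta>(1) N by (simp add: t_def)
    have "frob (t \<cdot>\<^sub>m X) = t * frob X" using t by (simp add: frob_smult)
    also have "\<dots> < t * N" using t by (simp add: N_def)
    also have "t * N = \<delta>" using N by (simp add: t_def)
    finally have "\<bar>\<langle>D, t \<cdot>\<^sub>m X\<rangle>\<bar> \<le> \<bar>\<langle>D, X\<rangle>\<bar> / N * frob (t \<cdot>\<^sub>m X)"
      by (intro \<delta>(2) cone X)
    then have "t * \<bar>\<langle>D, X\<rangle>\<bar> \<le> t * (\<bar>\<langle>D, X\<rangle>\<bar> / N * frob X)"
      using t S X by (subst (asm) frob_inner_smult_right) (auto simp: frob_smult abs_mult mult_ac)
    then have "\<bar>\<langle>D, X\<rangle>\<bar> * N \<le> \<bar>\<langle>D, X\<rangle>\<bar> * frob X"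
      using t N by (simp add: field_simps)
    with \<open>\<langle>D, X\<rangle> \<noteq> 0\<close> show False by (simp add: N_def)
  qed
qed (auto simp: smallo_near_zero_iff intro: exI[of _ 1])

lemma smallo_iff_gradient_orthogonal:
  assumes S: "S \<subseteq> carrier_mat (dim_row D) (dim_col D)"
    and cone: "\<And>t X. X \<in> S \<Longrightarrow> t \<cdot>\<^sub>m X \<in> S"
    and c: "c \<noteq> 0"
    and expansion: "(\<lambda>X. f X - c * \<langle>D, X\<rangle>) \<in> O[near_zero S](\<lambda>X. (frob X)\<^sup>2)"
  shows "f \<in> o[near_zero S](frob) \<longleftrightarrow> (\<forall>X\<in>S. \<langle>D, X\<rangle> = 0)"
proof -
  have "frob \<in> o[near_zero S](\<lambda>_. 1)"
    by (intro smalloI_tendsto) (use frob_tendsto_near_zero in auto)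
  then have "(\<lambda>X. (frob X)\<^sup>2) \<in> o[near_zero S](frob)"
    using landau_o.small_big_mult[of frob "near_zero S" "\<lambda>_. 1" frob frob] by (simp add: power2_eq_square)
  then have remainder: "(\<lambda>X. f X - c * \<langle>D, X\<rangle>) \<in> o[near_zero S](frob)"
    by (rule landau_o.big_small_trans[OF expansion])
  have "f \<in> o[near_zero S](frob) \<longleftrightarrow> (\<lambda>X. c * \<langle>D, X\<rangle>) \<in> o[near_zero S](frob)"
    using sum_in_smallo(1)[OF remainder, of "\<lambda>X. c * \<langle>D, X\<rangle>"] sum_in_smallo(2)[OF _ remainder, of f]
    by auto
  then show ?thesis
    using c frob_inner_smallo_iff[OF S cone] by simp
qed

lemma frob_inner_nondegenerate: "(\<forall>X\<in>carrier_mat r c. \<langle>D, X\<rangle> = 0) \<longleftrightarrow> D = 0\<^sub>m r c"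
  if "D \<in> carrier_mat r c"
proof
  assume "\<forall>X\<in>carrier_mat r c. \<langle>D, X\<rangle> = 0"
  then show "D = 0\<^sub>m r c"
    using that frob_inner_self[of D] frob_eq_0_iff[of D] by auto
qed (metis carrier_matD frob_inner_zero_left)

lemma orthogonal_symmetric_iff_skew:
  assumes M: "M \<in> carrier_mat n n"
  shows "(\<forall>X\<in>{X \<in> carrier_mat n n. X\<^sup>T = X}. \<langle>M, X\<rangle> = 0) \<longleftrightarrow> M\<^sup>T = - M"
proof
  assume orth: "\<forall>X\<in>{X \<in> carrier_mat n n. X\<^sup>T = X}. \<langle>M, X\<rangle> = 0"
  let ?X = "M\<^sup>T + M"
  have X: "?X \<in> carrier_mat n n" "?X\<^sup>T = ?X"
    using M by (auto simp: transpose_add_dim comm_add_mat[of M n n])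
  then have "\<langle>M, ?X\<rangle> = 0" using orth by blast
  moreover have "\<langle>M\<^sup>T, ?X\<rangle> = \<langle>M, ?X\<rangle>"
    using frob_inner_transpose[of M ?X] M X by simp
  ultimately have "\<langle>?X, ?X\<rangle> = 0" using M by (simp add: frob_inner_add_left)
  then have "?X = 0\<^sub>m n n" using frob_inner_self[of ?X] frob_eq_0_iff[of ?X] M by simp
  then show "M\<^sup>T = - M" using M by (simp add: add_mat_eq_0_iff[of _ n n])
next
  assume skew: "M\<^sup>T = - M"
  have "\<langle>M, X\<rangle> = 0" if "X \<in> carrier_mat n n" "X\<^sup>T = X" for X
    using frob_inner_transpose[of M X] that M by (simp add: skew frob_inner_uminus_left)
  then show "\<forall>X\<in>{X \<in> carrier_mat n n. X\<^sup>T = X}. \<langle>M, X\<rangle> = 0" by blast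
qed

subsection \<open>Sylvester equations\<close>

text \<open>The columns of \<open>Y\<close> vanish one after the other: the first nonzero one would be an eigenvector
  of \<open>A\<close> for a diagonal entry of \<open>T\<close>.\<close>

lemma upper_triangular_intertwiner_eq_0:
  fixes A T Y :: "'a::field mat"
  assumes A: "A \<in> carrier_mat n n" and T: "T \<in> carrier_mat m m" "upper_triangular T"
    and Y: "Y \<in> carrier_mat n m" and intertwines: "A * Y = Y * T"
    and diag: "\<And>j. j < m \<Longrightarrow> \<not> eigenvalue A (T $$ (j,j))"
  shows "Y = 0\<^sub>m n m"
proof -
  have "col Y j = 0\<^sub>v n" if "j < m" for j
    using that
  proof (induction j rule: less_induct)
    case (less j)
    have earlier: "Y $$ (i,k) = 0" if "k < j" "i < n" for i k
      using less.IH[OF that(1)] that less.prems Y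
      by (metis carrier_matD index_col index_zero_vec(1) less_trans)
    have "A *\<^sub>v col Y j = T $$ (j,j) \<cdot>\<^sub>v col Y j"
    proof (rule eq_vecI)
      fix i assume "i < dim_vec (T $$ (j,j) \<cdot>\<^sub>v col Y j)"
      then have i: "i < n" using Y by simp
      have "(A *\<^sub>v col Y j) $ i = (\<Sum>k<m. Y $$ (i,k) * T $$ (k,j))"
        using arg_cong[OF intertwines, of "\<lambda>M. M $$ (i,j)"] i less.prems A T Y
        by (simp add: scalar_prod_def atLeast0LessThan)
      also have "\<dots> = (\<Sum>k<m. if k = j then Y $$ (i,k) * T $$ (k,j) else 0)"
      proof (rule sum.cong[OF refl])
        fix k assume "k \<in> {..<m}"
        then show "Y $$ (i,k) * T $$ (k,j) = (if k = j then Y $$ (i,k) * T $$ (k,j) else 0)"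
          using earlier[of k i] i T(1) upper_triangularD[OF T(2), of j k]
          by (cases k j rule: linorder_cases) auto
      qed
      also have "\<dots> = (T $$ (j,j) \<cdot>\<^sub>v col Y j) $ i"
        using less.prems i Y by (simp add: mult.commute)
      finally show "(A *\<^sub>v col Y j) $ i = (T $$ (j,j) \<cdot>\<^sub>v col Y j) $ i" .
    qed (use A Y in auto)
    moreover have "col Y j \<in> carrier_vec n"
      using Y less.prems by simp
    ultimately show ?case
      using diag[OF less.prems] A unfolding eigenvalue_def eigenvector_def by auto
  qed
  then show ?thesis
    using Y by (intro eq_matI) (auto simp flip: index_col)
qed

lemma intertwiner_eq_0:
  fixes A M X :: "complex mat"
  assumes A: "A \<in> carrier_mat n n" and M: "M \<in> carrier_mat m m" and X: "X \<in> carrier_mat n m"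
    and intertwines: "A * X = X * M" and disjoint: "\<And>k. eigenvalue M k \<Longrightarrow> \<not> eigenvalue A k"
  shows "X = 0\<^sub>m n m"
proof -
  obtain es where es: "char_poly M = (\<Prod>a\<leftarrow>es. [:- a, 1:])"
    using char_poly_factorized[OF M] by auto
  obtain T S S' where "schur_decomposition M es = (T, S, S')"
    using prod_cases3 by blast
  from schur_decomposition[OF M es this]
  have wit: "similar_mat_wit M T S S'" and T: "upper_triangular T" "diag_mat T = es" by auto
  note S = similar_mat_witD2[OF M wit]
  have "X * S = 0\<^sub>m n m"
  proof (rule upper_triangular_intertwiner_eq_0[OF A S(5) T(1)])
    have "A * (X * S) = X * M * S"
      using A X S(6) by (simp add: assoc_mult_mat_dim[symmetric] intertwines del: assoc_mult_mat)
    also have "\<dots> = X * (S * T * (S' * S))"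
      using X S(5-7) by (subst S(3)) (simp add: assoc_mult_mat_dim del: assoc_mult_mat)
    also have "\<dots> = X * S * T"
      using X S(2,5,6) by (simp add: assoc_mult_mat_dim del: assoc_mult_mat)
    finally show "A * (X * S) = X * S * T" .
    fix j assume "j < m"
    then have "T $$ (j,j) \<in> set es"
      using S(5) by (auto simp: T(2)[symmetric] diag_mat_def)
    then have "eigenvalue M (T $$ (j,j))"
      by (auto simp: eigenvalue_root_char_poly[OF M] es poly_prod_list prod_list_zero_iff)
    then show "\<not> eigenvalue A (T $$ (j,j))" by (rule disjoint)
  qed (use X S(6) in auto)
  then have "X * (S * S') = 0\<^sub>m n m"
    using X S(6,7) by (simp add: assoc_mult_mat_dim[symmetric] del: assoc_mult_mat)
  then show ?thesis using X S(1) by simp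
qed

lemma eigenvalue_transpose:
  "A \<in> carrier_mat n n \<Longrightarrow> eigenvalue A\<^sup>T k \<longleftrightarrow> eigenvalue A k" for A :: "'a::field mat"
  by (simp add: eigenvalue_root_char_poly[of _ n])

lemma eigenvalue_uminus:
  fixes A :: "'a::field mat"
  assumes A: "A \<in> carrier_mat n n" and "eigenvalue (- A) k"
  shows "eigenvalue A (- k)"
proof -
  obtain v where v: "v \<in> carrier_vec n" "v \<noteq> 0\<^sub>v n" "- A *\<^sub>v v = k \<cdot>\<^sub>v v"
    using assms unfolding eigenvalue_def eigenvector_def by auto
  have "A *\<^sub>v v = - (- A *\<^sub>v v)"
    using A v(1) by (simp add: uminus_mult_mat_vec)
  also have "\<dots> = (- k) \<cdot>\<^sub>v v"
    unfolding v(3) by (intro eq_vecI) auto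
  finally show ?thesis
    using A v(1,2) unfolding eigenvalue_def eigenvector_def by auto
qed

lemma hurwitz_transpose:
  assumes "hurwitz A"
  shows "hurwitz A\<^sup>T"
proof -
  have A: "A \<in> carrier_mat (dim_row A) (dim_row A)" using assms by (simp add: hurwitz_def)
  have "eigenvalue (map_mat complex_of_real A\<^sup>T) k \<longleftrightarrow> eigenvalue (map_mat complex_of_real A) k" for k
    using A eigenvalue_transpose[of "map_mat complex_of_real A"] by (simp add: map_mat_transpose)
  then show ?thesis
    using assms carrier_matD(2)[OF A] A
    unfolding hurwitz_def index_transpose_mat transpose_carrier_mat by metis
qed

definition sylvester :: "real mat \<Rightarrow> real mat \<Rightarrow> real mat \<Rightarrow> real mat" where
  "sylvester A B X = A * X + X * B"

lemma sylvester_dim [simp]: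
  "dim_row (sylvester A B X) = dim_row X" "dim_col (sylvester A B X) = dim_col B"
  by (simp_all add: sylvester_def)

lemma sylvester_carrier [simp]:
  "X \<in> carrier_mat n m \<Longrightarrow> B \<in> carrier_mat m m \<Longrightarrow> sylvester A B X \<in> carrier_mat n m"
  by (simp add: sylvester_def)

definition sylvester_regular :: "real mat \<Rightarrow> real mat \<Rightarrow> bool" where
  "sylvester_regular A B \<longleftrightarrow>
    (\<forall>X\<in>carrier_mat (dim_row A) (dim_row B).
      sylvester A B X = 0\<^sub>m (dim_row A) (dim_row B) \<longrightarrow> X = 0\<^sub>m (dim_row A) (dim_row B))"

lemma hurwitz_imp_sylvester_regular:
  assumes "hurwitz A" "hurwitz B"
  shows "sylvester_regular A B"
  unfolding sylvester_regular_def
proof (intro ballI impI)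
  let ?h = "map_mat complex_of_real"
  define n m where "n = dim_row A" and "m = dim_row B"
  have A: "A \<in> carrier_mat n n" and B: "B \<in> carrier_mat m m"
    using assms by (auto simp: hurwitz_def n_def m_def)
  fix X assume "X \<in> carrier_mat (dim_row A) (dim_row B)" "sylvester A B X = 0\<^sub>m (dim_row A) (dim_row B)"
  then have X: "X \<in> carrier_mat n m" and "A * X = X * (- B)"
    using A B by (auto simp: sylvester_def add_mat_eq_0_iff[of _ n m])
  then have "?h A * ?h X = ?h X * ?h (- B)"
    using of_real_hom.mat_hom_mult[OF A X] of_real_hom.mat_hom_mult[OF X, of "- B" m] B
    by (metis uminus_carrier_iff_mat)
  moreover have "?h (- B) = - ?h B" by (intro eq_matI) auto
  ultimately have intertwines: "?h A * ?h X = ?h X * (- ?h B)" by simp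
  have "\<not> eigenvalue (?h A) k" if "eigenvalue (- ?h B) k" for k
  proof -
    have "eigenvalue (?h B) (- k)"
      using that B by (intro eigenvalue_uminus[of _ m]) auto
    then have "Re k > 0" using \<open>hurwitz B\<close> unfolding hurwitz_def by force
    then show ?thesis using \<open>hurwitz A\<close> unfolding hurwitz_def by force
  qed
  then have "?h X = 0\<^sub>m n m"
    using A B X by (intro intertwiner_eq_0[OF _ _ _ intertwines]) auto
  then show "X = 0\<^sub>m (dim_row A) (dim_row B)" using A B X by (auto simp: mat_eq_iff)
qed

definition vectorize :: "real mat \<Rightarrow> real mat" where
  "vectorize X = mat (dim_row X * dim_col X) 1 (\<lambda>(s,_). X $$ (s div dim_col X, s mod dim_col X))"

lemma vectorize_carrier [simp]: "X \<in> carrier_mat n m \<Longrightarrow> vectorize X \<in> carrier_mat (n * m) 1"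
  by (auto simp: vectorize_def)

lemma div_mod_less: "s < n * m \<Longrightarrow> s div m < n" "s < n * m \<Longrightarrow> s mod m < m" for s n m :: nat
  by (simp add: less_mult_imp_div_less) (cases "m = 0"; simp)

lemma mult_add_less: "i < n \<Longrightarrow> j < m \<Longrightarrow> i * m + j < n * m" for i j n m :: nat
  using mult_le_mono1[of "Suc i" n m] by simp

lemma sum_div_mod:
  "(\<Sum>s<n * m. f (s div m) (s mod m)) = (\<Sum>i<n. \<Sum>j<m. f i j)" for f :: "nat \<Rightarrow> nat \<Rightarrow> 'a::comm_monoid_add"
proof -
  have "(\<Sum>s\<in>{i * m..<i * m + m}. f (s div m) (s mod m)) = (\<Sum>j<m. f i j)" for i
    using sum.shift_bounds_nat_ivl[of "\<lambda>s. f (s div m) (s mod m)" 0 "i * m" m]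
    by (simp add: atLeast0LessThan add.commute)
  then show ?thesis by (simp flip: sum.nat_group)
qed

lemma frob_vectorize: "frob (vectorize X) = frob X"
  using sum_div_mod[of "\<lambda>i j. (X $$ (i,j))\<^sup>2" "dim_col X" "dim_row X"]
  by (simp add: frob_def vectorize_def)

lemma vectorize_inject:
  assumes "X \<in> carrier_mat n m" "Y \<in> carrier_mat n m" "vectorize X = vectorize Y"
  shows "X = Y"
proof (rule eq_matI)
  fix i j assume "i < dim_row Y" "j < dim_col Y"
  then have ij: "i < n" "j < m" using assms by auto
  have "vectorize Z $$ (i * m + j, 0) = Z $$ (i,j)" if "Z \<in> carrier_mat n m" for Z
    using that ij mult_add_less[OF ij] by (simp add: vectorize_def)
  then show "X $$ (i,j) = Y $$ (i,j)" using assms by metis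
qed (use assms in auto)

lemma vectorize_surj:
  assumes "v \<in> carrier_mat (n * m) 1"
  obtains X where "X \<in> carrier_mat n m" "vectorize X = v"
proof
  show "vectorize (mat n m (\<lambda>(i,j). v $$ (i * m + j, 0))) = v"
    using assms by (intro eq_matI)
      (auto simp: vectorize_def div_mod_less)
qed auto

text \<open>The Kronecker matrix of \<open>X \<mapsto> A X + X B\<close> in row-major coordinates.\<close>

definition sylvester_mat :: "real mat \<Rightarrow> real mat \<Rightarrow> real mat" where
  "sylvester_mat A B = (let n = dim_row A; m = dim_row B in mat (n * m) (n * m) (\<lambda>(r,s).
     (if r mod m = s mod m then A $$ (r div m, s div m) else 0) +
     (if r div m = s div m then B $$ (s mod m, r mod m) else 0)))"

lemma sylvester_mat_vectorize:
  assumes A: "A \<in> carrier_mat n n" and B: "B \<in> carrier_mat m m" and X: "X \<in> carrier_mat n m"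
  shows "sylvester_mat A B * vectorize X = vectorize (sylvester A B X)"
proof (rule eq_matI)
  fix r c assume "r < dim_row (vectorize (sylvester A B X))" "c < dim_col (vectorize (sylvester A B X))"
  then have r: "r < n * m" and c: "c = 0" using B X by (auto simp: vectorize_def sylvester_def)
  define i j where "i = r div m" and "j = r mod m"
  have ij: "i < n" "j < m"
    using r by (auto simp: i_def j_def div_mod_less)
  have "(sylvester_mat A B * vectorize X) $$ (r,c) =
      (\<Sum>s<n * m. ((if j = s mod m then A $$ (i, s div m) else 0) +
          (if i = s div m then B $$ (s mod m, j) else 0)) * X $$ (s div m, s mod m))"
    using r c A B X unfolding i_def j_def
    by (simp add: index_mult_mat_sum sylvester_mat_def vectorize_def Let_def del: index_mult_mat(1))
  also have "\<dots> = (\<Sum>k<n. \<Sum>l<m. ((if j = l then A $$ (i,k) else 0) +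
      (if i = k then B $$ (l,j) else 0)) * X $$ (k,l))"
    by (rule sum_div_mod)
  also have "\<dots> = (\<Sum>k<n. \<Sum>l<m. if j = l then A $$ (i,k) * X $$ (k,l) else 0)
      + (\<Sum>k<n. \<Sum>l<m. if i = k then B $$ (l,j) * X $$ (k,l) else 0)"
    unfolding sum.distrib[symmetric] by (intro sum.cong refl) (auto simp: algebra_simps)
  also have "(\<Sum>k<n. \<Sum>l<m. if j = l then A $$ (i,k) * X $$ (k,l) else 0) = (A * X) $$ (i,j)"
    using ij A X by (simp add: index_mult_mat_sum del: index_mult_mat(1))
  also have "(\<Sum>k<n. \<Sum>l<m. if i = k then B $$ (l,j) * X $$ (k,l) else 0) = (X * B) $$ (i,j)"
    using ij B X by (subst sum.swap) (simp add: index_mult_mat_sum mult.commute del: index_mult_mat(1))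
  also have "(A * X) $$ (i,j) + (X * B) $$ (i,j) = vectorize (sylvester A B X) $$ (r,c)"
    using r c ij B X by (simp add: vectorize_def sylvester_def i_def j_def)
  finally show "(sylvester_mat A B * vectorize X) $$ (r,c) = vectorize (sylvester A B X) $$ (r,c)" .
qed (use A B X in \<open>auto simp: sylvester_mat_def vectorize_def sylvester_def Let_def\<close>)

lemma sylvester_mat_inverse:
  assumes A: "A \<in> carrier_mat n n" and B: "B \<in> carrier_mat m m" and regular: "sylvester_regular A B"
  obtains K where "K \<in> carrier_mat (n * m) (n * m)"
    "K * sylvester_mat A B = 1\<^sub>m (n * m)" "sylvester_mat A B * K = 1\<^sub>m (n * m)"
proof -
  have S: "sylvester_mat A B \<in> carrier_mat (n * m) (n * m)"
    using A B by (auto simp: sylvester_mat_def Let_def)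
  have "det (sylvester_mat A B) \<noteq> 0"
  proof
    assume "det (sylvester_mat A B) = 0"
    then obtain v where v: "v \<in> carrier_vec (n * m)" "v \<noteq> 0\<^sub>v (n * m)"
      "sylvester_mat A B *\<^sub>v v = 0\<^sub>v (n * m)"
      using det_0_iff_vec_prod_zero[OF S] by auto
    obtain X where X: "X \<in> carrier_mat n m" "vectorize X = mat_of_cols (n * m) [v]"
      using vectorize_surj[of "mat_of_cols (n * m) [v]" n m] mat_of_cols_carrier(1)[of "n * m" "[v]"]
      by auto
    have "vectorize (sylvester A B X) = sylvester_mat A B * mat_of_cols (n * m) [v]"
      using sylvester_mat_vectorize[OF A B X(1)] X(2) by simp
    also have "\<dots> = mat_of_cols (n * m) [0\<^sub>v (n * m)]"
      using S v by (intro mat_col_eqI) (auto simp: col_mult2[OF S mat_of_cols_carrier(1)[of _ "[v]"]])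
    also have "\<dots> = vectorize (0\<^sub>m n m)"
      by (intro eq_matI) (auto simp: vectorize_def div_mod_less mat_of_cols_index)
    finally have "sylvester A B X = 0\<^sub>m n m"
      using B X(1) by (intro vectorize_inject[of "sylvester A B X" n m "0\<^sub>m n m"]) auto
    then have "X = 0\<^sub>m n m"
      using regular A B X(1) by (auto simp: sylvester_regular_def)
    then have "mat_of_cols (n * m) [v] = 0\<^sub>m (n * m) 1"
      using X(2) by (auto simp: vectorize_def div_mod_less mat_eq_iff)
    then have "v = col (0\<^sub>m (n * m) 1) 0"
      using v(1)
      by (metis col_mat_of_cols length_greater_0_conv list.distinct(1) list.size(3) nth_Cons_0)
    with v(2) show False by simp
  qed
  then show ?thesis
    using det_non_zero_imp_unit[OF S, of "()"] that unfolding Units_def ring_mat_def by auto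
qed

lemma sylvester_unique_solution:
  assumes A: "A \<in> carrier_mat n n" and B: "B \<in> carrier_mat m m" and regular: "sylvester_regular A B"
    and W: "W \<in> carrier_mat n m"
  shows "\<exists>!X. X \<in> carrier_mat n m \<and> sylvester A B X = W"
proof -
  obtain K where K: "K \<in> carrier_mat (n * m) (n * m)"
    "K * sylvester_mat A B = 1\<^sub>m (n * m)" "sylvester_mat A B * K = 1\<^sub>m (n * m)"
    using sylvester_mat_inverse[OF A B regular] .
  have S: "dim_row (sylvester_mat A B) = n * m" "dim_col (sylvester_mat A B) = n * m"
    using A B by (simp_all add: sylvester_mat_def Let_def)
  have solves_iff: "sylvester A B X = W \<longleftrightarrow> vectorize X = K * vectorize W"
    if X: "X \<in> carrier_mat n m" for X
  proof
    assume "sylvester A B X = W"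
    then have "K * vectorize W = K * sylvester_mat A B * vectorize X"
      using K(1) S X vectorize_carrier[OF X]
      by (simp add: assoc_mult_mat_dim sylvester_mat_vectorize[OF A B X] del: assoc_mult_mat)
    then show "vectorize X = K * vectorize W" using vectorize_carrier[OF X] by (simp add: K(2))
  next
    assume "vectorize X = K * vectorize W"
    then have "vectorize (sylvester A B X) = sylvester_mat A B * K * vectorize W"
      using K(1) S vectorize_carrier[OF W]
      by (simp add: assoc_mult_mat_dim sylvester_mat_vectorize[OF A B X, symmetric] del: assoc_mult_mat)
    then have "vectorize (sylvester A B X) = vectorize W"
      using vectorize_carrier[OF W] by (simp add: K(3))
    then show "sylvester A B X = W" using X B W
      by (intro vectorize_inject[of "sylvester A B X" n m W]) auto
  qed
  obtain X where X: "X \<in> carrier_mat n m" "vectorize X = K * vectorize W"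
    using vectorize_surj[OF mult_carrier_mat[OF K(1) vectorize_carrier[OF W]]] .
  show ?thesis
  proof (rule ex1I[of _ X])
    fix Y assume "Y \<in> carrier_mat n m \<and> sylvester A B Y = W"
    then show "Y = X" using X solves_iff[of Y] by (intro vectorize_inject[of Y n m X]) auto
  qed (use X solves_iff in auto)
qed

lemma sylvester_bounded_below:
  assumes A: "A \<in> carrier_mat n n" and B: "B \<in> carrier_mat m m" and regular: "sylvester_regular A B"
  obtains \<kappa> where "\<kappa> \<ge> 0" "\<And>X. X \<in> carrier_mat n m \<Longrightarrow> frob X \<le> \<kappa> * frob (sylvester A B X)"
proof -
  obtain K where K: "K \<in> carrier_mat (n * m) (n * m)" "K * sylvester_mat A B = 1\<^sub>m (n * m)"
    using sylvester_mat_inverse[OF A B regular] .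
  have S: "dim_row (sylvester_mat A B) = n * m" "dim_col (sylvester_mat A B) = n * m"
    using A B by (simp_all add: sylvester_mat_def Let_def)
  have "frob X \<le> frob K * frob (sylvester A B X)" if X: "X \<in> carrier_mat n m" for X
  proof -
    have "vectorize X = K * sylvester_mat A B * vectorize X"
      using vectorize_carrier[OF X] by (simp add: K(2))
    also have "\<dots> = K * vectorize (sylvester A B X)"
      using K(1) S vectorize_carrier[OF X]
      by (simp add: assoc_mult_mat_dim sylvester_mat_vectorize[OF A B X] del: assoc_mult_mat)
    finally have "frob X = frob (K * vectorize (sylvester A B X))"
      by (metis frob_vectorize)
    also have "\<dots> \<le> frob K * frob (vectorize (sylvester A B X))"
      using K(1) B X by (intro frob_mult_le) (auto simp: vectorize_def sylvester_def)
    finally show ?thesis by (simp add: frob_vectorize)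
  qed
  then show ?thesis using that[of "frob K"] by simp
qed

lemma sylvester_add_coeffs:
  "A \<in> carrier_mat n n \<Longrightarrow> A' \<in> carrier_mat n n \<Longrightarrow> B \<in> carrier_mat m m \<Longrightarrow> B' \<in> carrier_mat m m \<Longrightarrow>
   X \<in> carrier_mat n m \<Longrightarrow> sylvester (A + A') (B + B') X = sylvester A B X + sylvester A' B' X"
  by (intro eq_matI) (auto simp: sylvester_def add_mult_distrib_mat_dim mult_add_distrib_mat_dim
      simp del: index_mult_mat(1))

lemma sylvester_diff:
  "A \<in> carrier_mat n n \<Longrightarrow> B \<in> carrier_mat m m \<Longrightarrow> X \<in> carrier_mat n m \<Longrightarrow> Y \<in> carrier_mat n m \<Longrightarrow>
   sylvester A B (X - Y) = sylvester A B X - sylvester A B Y"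
  by (intro eq_matI) (auto simp: sylvester_def mult_minus_distrib_mat[of _ n n _ m]
      minus_mult_distrib_mat[of _ n m _ _ m] simp del: index_mult_mat(1))

lemma transpose_sylvester:
  "A \<in> carrier_mat n n \<Longrightarrow> B \<in> carrier_mat m m \<Longrightarrow> X \<in> carrier_mat n m \<Longrightarrow>
   (sylvester A B X)\<^sup>T = sylvester B\<^sup>T A\<^sup>T X\<^sup>T"
  by (simp add: sylvester_def transpose_add_dim transpose_mult_dim comm_add_mat[of _ m n])

lemma frob_inner_sylvester:
  "A \<in> carrier_mat n n \<Longrightarrow> B \<in> carrier_mat m m \<Longrightarrow> X \<in> carrier_mat n m \<Longrightarrow> Y \<in> carrier_mat n m \<Longrightarrow>
   \<langle>Y, sylvester A B X\<rangle> = \<langle>sylvester A\<^sup>T B\<^sup>T Y, X\<rangle>"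
  by (simp add: sylvester_def frob_inner_add_left frob_inner_add_right
      frob_inner_mult_left_adjoint[of _ A X] frob_inner_mult_right_adjoint[of _ X B])

lemma frob_sylvester_le:
  assumes "A \<in> carrier_mat n n" "B \<in> carrier_mat m m" "X \<in> carrier_mat n m"
  shows "frob (sylvester A B X) \<le> (frob A + frob B) * frob X"
proof -
  have "frob (sylvester A B X) \<le> frob (A * X) + frob (X * B)"
    using assms unfolding sylvester_def by (intro frob_triangle_ineq) auto
  also have "\<dots> \<le> frob A * frob X + frob X * frob B"
    using assms by (intro add_mono frob_mult_le) auto
  finally show ?thesis by (simp add: algebra_simps)
qed

lemma sylvester_perturbed_bounded_below:
  assumes A: "A \<in> carrier_mat n n" "dA \<in> carrier_mat n n"
    and B: "B \<in> carrier_mat m m" "dB \<in> carrier_mat m m"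
    and X: "X \<in> carrier_mat n m"
    and bound: "frob X \<le> \<kappa> * frob (sylvester A B X)" "\<kappa> \<ge> 0"
    and small: "2 * \<kappa> * (frob dA + frob dB) \<le> 1"
  shows "frob X \<le> 2 * \<kappa> * frob (sylvester (A + dA) (B + dB) X)"
proof -
  let ?Y = "sylvester (A + dA) (B + dB) X"
  have "sylvester A B X = ?Y + - sylvester dA dB X"
    using A B X by (intro eq_matI) (auto simp: sylvester_add_coeffs[of _ n _ _ m])
  then have "frob (sylvester A B X) \<le> frob ?Y + frob (sylvester dA dB X)"
    using B X frob_triangle_ineq[of ?Y "- sylvester dA dB X"] by (simp add: sylvester_def)
  also have "\<dots> \<le> frob ?Y + (frob dA + frob dB) * frob X"
    using A B X by (intro add_left_mono frob_sylvester_le) auto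
  finally have "\<kappa> * frob (sylvester A B X) \<le> \<kappa> * (frob ?Y + (frob dA + frob dB) * frob X)"
    using bound(2) by (intro mult_left_mono) auto
  moreover have "2 * \<kappa> * (frob dA + frob dB) * frob X \<le> 1 * frob X"
    using small by (intro mult_right_mono) auto
  ultimately show ?thesis using bound(1) by (simp add: algebra_simps)
qed

lemma sylvester_regular_if_bounded_below:
  assumes A: "A \<in> carrier_mat n n" and B: "B \<in> carrier_mat m m"
    and bound: "\<And>X. X \<in> carrier_mat n m \<Longrightarrow> frob X \<le> \<kappa> * frob (sylvester A B X)"
  shows "sylvester_regular A B"
  unfolding sylvester_regular_def
proof (intro ballI impI)
  fix X assume "X \<in> carrier_mat (dim_row A) (dim_row B)"
    and ker: "sylvester A B X = 0\<^sub>m (dim_row A) (dim_row B)"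
  then have X: "X \<in> carrier_mat n m" using A B by simp
  have "frob X = 0" using bound[OF X] by (simp add: ker order_antisym)
  then show "X = 0\<^sub>m (dim_row A) (dim_row B)" using A B X frob_eq_0_iff[of X] by simp
qed

lemma eventually_sylvester_bounded_below:
  fixes dA dB :: "'x \<Rightarrow> real mat"
  assumes A: "A \<in> carrier_mat n n" and B: "B \<in> carrier_mat m m" and regular: "sylvester_regular A B"
    and dims: "\<forall>\<^sub>F x in F. dA x \<in> carrier_mat n n" "\<forall>\<^sub>F x in F. dB x \<in> carrier_mat m m"
    and lim: "((\<lambda>x. frob (dA x)) \<longlongrightarrow> 0) F" "((\<lambda>x. frob (dB x)) \<longlongrightarrow> 0) F"
  obtains \<kappa> where
    "\<forall>\<^sub>F x in F. \<forall>X\<in>carrier_mat n m. frob X \<le> \<kappa> * frob (sylvester (A + dA x) (B + dB x) X)"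
proof -
  obtain \<kappa> where \<kappa>: "\<kappa> \<ge> 0" "\<And>X. X \<in> carrier_mat n m \<Longrightarrow> frob X \<le> \<kappa> * frob (sylvester A B X)"
    using sylvester_bounded_below[OF A B regular] by metis
  have "((\<lambda>x. 2 * \<kappa> * (frob (dA x) + frob (dB x))) \<longlongrightarrow> 2 * \<kappa> * (0 + 0)) F"
    by (intro tendsto_intros lim)
  then have "\<forall>\<^sub>F x in F. 2 * \<kappa> * (frob (dA x) + frob (dB x)) < 1"
    by (intro order_tendstoD(2)) auto
  then have "\<forall>\<^sub>F x in F. \<forall>X\<in>carrier_mat n m.
      frob X \<le> 2 * \<kappa> * frob (sylvester (A + dA x) (B + dB x) X)"
    using dims
  proof eventually_elim
    case (elim x)
    show ?case
    proof
      fix X :: "real mat" assume "X \<in> carrier_mat n m"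
      then show "frob X \<le> 2 * \<kappa> * frob (sylvester (A + dA x) (B + dB x) X)"
        using A B \<kappa> elim by (intro sylvester_perturbed_bounded_below[of _ n _ _ m]) auto
    qed
  qed
  then show ?thesis by (rule that)
qed

subsection \<open>Gramians and the quadratic cost\<close>

definition gramian :: "real mat \<Rightarrow> real mat \<Rightarrow> real mat" where
  "gramian A B = (THE P. P \<in> carrier_mat (dim_row A) (dim_row A) \<and>
     A * P + P * A\<^sup>T + B * B\<^sup>T = 0\<^sub>m (dim_row A) (dim_row A))"

definition h2_cost :: "real mat \<Rightarrow> real mat \<Rightarrow> real mat \<Rightarrow> real" where
  "h2_cost A B C = mtrace (C * gramian A B * C\<^sup>T)"

lemma gramian_solution:
  assumes A: "A \<in> carrier_mat n n" and B: "B \<in> carrier_mat n m" and regular: "sylvester_regular A A\<^sup>T"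
  shows gramian_carrier: "gramian A B \<in> carrier_mat n n"
    and gramian_equation: "sylvester A A\<^sup>T (gramian A B) = - (B * B\<^sup>T)"
    and gramian_symmetric: "(gramian A B)\<^sup>T = gramian A B"
proof -
  have At: "A\<^sup>T \<in> carrier_mat n n" and W: "- (B * B\<^sup>T) \<in> carrier_mat n n" using A B by auto
  note ex1 = sylvester_unique_solution[OF A At regular W]
  have "X \<in> carrier_mat n n \<and> A * X + X * A\<^sup>T + B * B\<^sup>T = 0\<^sub>m n n \<longleftrightarrow>
      X \<in> carrier_mat n n \<and> sylvester A A\<^sup>T X = - (B * B\<^sup>T)" for X
    using A B by (auto simp: sylvester_def add_mat_eq_0_iff[of _ n n])
  then have "gramian A B = (THE X. X \<in> carrier_mat n n \<and> sylvester A A\<^sup>T X = - (B * B\<^sup>T))"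
    using A by (simp add: gramian_def)
  with theI'[OF ex1] show P: "gramian A B \<in> carrier_mat n n"
    "sylvester A A\<^sup>T (gramian A B) = - (B * B\<^sup>T)"
    by simp_all
  have "sylvester A A\<^sup>T (gramian A B)\<^sup>T = (- (B * B\<^sup>T))\<^sup>T"
    using transpose_sylvester[OF A At P(1)] P(2) by simp
  also have "\<dots> = - (B * B\<^sup>T)" using B by (simp add: transpose_uminus transpose_mult_dim)
  finally show "(gramian A B)\<^sup>T = gramian A B"
    using ex1 P by (metis transpose_carrier_mat)
qed

lemma mtrace_congruence:
  assumes "P \<in> carrier_mat n n" "C \<in> carrier_mat q n"
  shows "mtrace (C * P * C\<^sup>T) = \<langle>C\<^sup>T * C, P\<rangle>"
  using assms mtrace_mult_commute[of "C * P" "C\<^sup>T"] mtrace_mult_commute[of "C\<^sup>T * C" P]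
  by (simp add: frob_inner_def mat_dim_simps del: assoc_mult_mat)

lemma frob_inner_gram_add:
  assumes Q: "Q \<in> carrier_mat n n" "Q\<^sup>T = Q" and B: "B \<in> carrier_mat n m" "dB \<in> carrier_mat n m"
  shows "\<langle>Q, (B + dB) * (B + dB)\<^sup>T\<rangle> = \<langle>Q, B * B\<^sup>T\<rangle> + 2 * \<langle>Q * B, dB\<rangle> + \<langle>Q, dB * dB\<^sup>T\<rangle>"
proof -
  have "\<langle>Q, dB * B\<^sup>T\<rangle> = \<langle>Q * B, dB\<rangle>"
    using Q(1) B by (subst frob_inner_mult_right_adjoint) auto
  moreover have "\<langle>Q, B * dB\<^sup>T\<rangle> = \<langle>Q, dB * B\<^sup>T\<rangle>"
    using Q B frob_inner_transpose[of Q "dB * B\<^sup>T"] by (simp add: transpose_mult_dim)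
  ultimately show ?thesis
    using Q(1) B by (simp add: mat_dim_simps frob_inner_add_right)
qed

lemma frob_inner_sylvester_symmetric:
  assumes "Q \<in> carrier_mat n n" "Q\<^sup>T = Q" "X \<in> carrier_mat n n" "X\<^sup>T = X" "A \<in> carrier_mat n n"
  shows "\<langle>Q, sylvester A A\<^sup>T X\<rangle> = 2 * \<langle>Q * X, A\<rangle>"
proof -
  have "\<langle>Q, A * X\<rangle> = \<langle>Q * X, A\<rangle>"
    using assms by (subst frob_inner_mult_right_adjoint) auto
  moreover have "\<langle>Q, X * A\<^sup>T\<rangle> = \<langle>Q, A * X\<rangle>"
    using assms frob_inner_transpose[of Q "A * X"] by (simp add: transpose_mult_dim)
  ultimately show ?thesis
    using assms by (simp add: sylvester_def frob_inner_add_right)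
qed

text \<open>The adjoint solution \<open>Q\<close> eliminates the change of the Gramian: \<open>\<langle>C\<^sup>T C, P' - P\<rangle>\<close> is turned
  into pairings of \<open>Q\<close> with the increments of the coefficients.\<close>

lemma lyapunov_cost_difference:
  assumes A: "A \<in> carrier_mat n n" "dA \<in> carrier_mat n n"
    and B: "B \<in> carrier_mat n m" "dB \<in> carrier_mat n m"
    and C: "C \<in> carrier_mat q n" "dC \<in> carrier_mat q n"
    and P: "P \<in> carrier_mat n n" "sylvester A A\<^sup>T P = - (B * B\<^sup>T)"
    and Q: "Q \<in> carrier_mat n n" "sylvester A\<^sup>T A Q = - (C\<^sup>T * C)" "Q\<^sup>T = Q"
    and P': "P' \<in> carrier_mat n n" "sylvester (A + dA) (A + dA)\<^sup>T P' = - ((B + dB) * (B + dB)\<^sup>T)"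
      "P'\<^sup>T = P'"
  shows "\<langle>(C + dC)\<^sup>T * (C + dC), P'\<rangle> - \<langle>C\<^sup>T * C, P\<rangle>
      = 2 * (\<langle>Q * P', dA\<rangle> + \<langle>Q * B, dB\<rangle> + \<langle>C * P', dC\<rangle>) + \<langle>Q, dB * dB\<^sup>T\<rangle> + \<langle>dC\<^sup>T * dC, P'\<rangle>"
proof -
  have duality: "\<langle>C\<^sup>T * C, X\<rangle> = - \<langle>Q, sylvester A A\<^sup>T X\<rangle>" if "X \<in> carrier_mat n n" for X
    using frob_inner_sylvester[of A n "A\<^sup>T" n X Q] A(1) C(1) Q that
    by (simp add: frob_inner_uminus_left)
  have inner_uminus: "\<langle>Q, - X\<rangle> = - \<langle>Q, X\<rangle>" if "X \<in> carrier_mat n n" for X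
    using that Q(1) by (simp add: frob_inner_commute[of Q] frob_inner_uminus_left)
  have output_term:
    "\<langle>(C + dC)\<^sup>T * (C + dC), P'\<rangle> = \<langle>C\<^sup>T * C, P'\<rangle> + 2 * \<langle>C * P', dC\<rangle> + \<langle>dC\<^sup>T * dC, P'\<rangle>"
    using frob_inner_gram_add[of P' n "C\<^sup>T" q "dC\<^sup>T"] frob_inner_transpose[of "C * P'" dC] P'(1,3) C
    by (simp add: frob_inner_commute[of P'] transpose_add_dim transpose_mult_dim)
  have "(A + dA)\<^sup>T = A\<^sup>T + dA\<^sup>T" using A by (simp add: transpose_add_dim)
  then have "sylvester A A\<^sup>T P' + sylvester dA dA\<^sup>T P' = - ((B + dB) * (B + dB)\<^sup>T)"
    using A P'(1,2) sylvester_add_coeffs[of A n dA "A\<^sup>T" n "dA\<^sup>T" P'] by simp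
  moreover have "(B + dB) * (B + dB)\<^sup>T \<in> carrier_mat n n"
    using B by (intro mult_carrier_mat[of _ n m]) auto
  ultimately have
    "\<langle>Q, sylvester A A\<^sup>T P'\<rangle> + \<langle>Q, sylvester dA dA\<^sup>T P'\<rangle> = - \<langle>Q, (B + dB) * (B + dB)\<^sup>T\<rangle>"
    using A P'(1) Q(1) by (simp add: inner_uminus frob_inner_add_right[symmetric])
  then have "\<langle>C\<^sup>T * C, P'\<rangle> = \<langle>Q, B * B\<^sup>T\<rangle> + 2 * \<langle>Q * P', dA\<rangle> + 2 * \<langle>Q * B, dB\<rangle> + \<langle>Q, dB * dB\<^sup>T\<rangle>"
    using duality[OF P'(1)] frob_inner_gram_add[OF Q(1,3) B]
      frob_inner_sylvester_symmetric[OF Q(1,3) P'(1,3) A(2)] by simp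
  moreover have "\<langle>C\<^sup>T * C, P\<rangle> = \<langle>Q, B * B\<^sup>T\<rangle>"
    using duality[OF P(1)] P(2) B(1) inner_uminus by simp
  ultimately show ?thesis using output_term by simp
qed

lemma lyapunov_cost_expansion:
  assumes A: "A \<in> carrier_mat n n" "dA \<in> carrier_mat n n"
    and B: "B \<in> carrier_mat n m" "dB \<in> carrier_mat n m"
    and C: "C \<in> carrier_mat q n" "dC \<in> carrier_mat q n"
    and P: "P \<in> carrier_mat n n" "sylvester A A\<^sup>T P = - (B * B\<^sup>T)"
    and Q: "Q \<in> carrier_mat n n" "sylvester A\<^sup>T A Q = - (C\<^sup>T * C)" "Q\<^sup>T = Q"
    and P': "P' \<in> carrier_mat n n" "sylvester (A + dA) (A + dA)\<^sup>T P' = - ((B + dB) * (B + dB)\<^sup>T)"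
      "P'\<^sup>T = P'"
  shows "\<langle>(C + dC)\<^sup>T * (C + dC), P'\<rangle> - \<langle>C\<^sup>T * C, P\<rangle> - 2 * (\<langle>Q * P, dA\<rangle> + \<langle>Q * B, dB\<rangle> + \<langle>C * P, dC\<rangle>)
      = 2 * \<langle>Q * (P' - P), dA\<rangle> + 2 * \<langle>C * (P' - P), dC\<rangle> + \<langle>Q, dB * dB\<^sup>T\<rangle> + \<langle>dC\<^sup>T * dC, P'\<rangle>"
proof -
  have split: "P' = P + (P' - P)" using P(1) P'(1) by (intro eq_matI) auto
  have "\<langle>Q * P', dA\<rangle> = \<langle>Q * P, dA\<rangle> + \<langle>Q * (P' - P), dA\<rangle>"
    "\<langle>C * P', dC\<rangle> = \<langle>C * P, dC\<rangle> + \<langle>C * (P' - P), dC\<rangle>"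
    using A C P(1) Q(1) P'(1) by (subst split; simp add: mult_add_distrib_mat_dim frob_inner_add_left)+
  then show ?thesis
    using lyapunov_cost_difference[OF A B C P Q P'] by simp
qed

lemma gramian_difference_equation:
  assumes A: "A \<in> carrier_mat n n" "dA \<in> carrier_mat n n"
    and B: "B \<in> carrier_mat n m" "dB \<in> carrier_mat n m"
    and P: "P \<in> carrier_mat n n" "sylvester A A\<^sup>T P = - (B * B\<^sup>T)"
    and P': "P' \<in> carrier_mat n n" "sylvester (A + dA) (A + dA)\<^sup>T P' = - ((B + dB) * (B + dB)\<^sup>T)"
  shows "sylvester (A + dA) (A + dA)\<^sup>T (P' - P)
    = - (sylvester dA dA\<^sup>T P + (B * dB\<^sup>T + dB * (B + dB)\<^sup>T))"
proof -
  have "sylvester (A + dA) (A + dA)\<^sup>T P = - (B * B\<^sup>T) + sylvester dA dA\<^sup>T P"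
    using A P sylvester_add_coeffs[of A n dA "A\<^sup>T" n "dA\<^sup>T" P] by (simp add: transpose_add_dim)
  then show ?thesis
    using A B P(1) P'
    by (subst sylvester_diff[of _ n _ n])
      (auto intro!: eq_matI simp: add_mult_distrib_mat_dim mult_add_distrib_mat_dim transpose_add_dim
        simp del: index_mult_mat(1))
qed

lemma gramian_residual_bigo:
  fixes dA dB :: "'x \<Rightarrow> real mat"
  assumes B: "B \<in> carrier_mat n m" and P: "P \<in> carrier_mat n n"
    and dims: "\<forall>\<^sub>F x in F. dA x \<in> carrier_mat n n" "\<forall>\<^sub>F x in F. dB x \<in> carrier_mat n m"
    and bigo: "(\<lambda>x. frob (dA x)) \<in> O[F](s)" "(\<lambda>x. frob (dB x)) \<in> O[F](s)"
    and s: "(s \<longlongrightarrow> 0) F"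
  shows "(\<lambda>x. frob (sylvester (dA x) (dA x)\<^sup>T P + (B * (dB x)\<^sup>T + dB x * (B + dB x)\<^sup>T))) \<in> O[F](s)"
proof -
  have "(\<lambda>x. frob (B + dB x)) \<in> O[F](\<lambda>_. 1)"
  proof (rule frob_add_bigo)
    show "(\<lambda>x. frob (dB x)) \<in> O[F](\<lambda>_. 1)"
      using landau_o.big_trans[OF bigo(2) bigoI_tendsto[where f = s and g = "\<lambda>_. 1" and c = 0]] s
      by simp
  qed (use dims(2) B in \<open>auto elim: eventually_mono\<close>)
  then have "(\<lambda>x. frob (dB x * (B + dB x)\<^sup>T)) \<in> O[F](\<lambda>x. s x * 1)"
    using dims(2) B bigo(2) by (intro frob_mult_bigo) (auto elim: eventually_mono)
  then show ?thesis
    unfolding sylvester_def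
    using dims B P bigo
    by (intro frob_add_bigo frob_const_mult_bigo frob_mult_const_bigo)
      (auto elim: eventually_mono eventually_elim2)
qed

lemma
  fixes dA dB :: "'x \<Rightarrow> real mat"
  assumes A: "A \<in> carrier_mat n n" and B: "B \<in> carrier_mat n m" and regular: "sylvester_regular A A\<^sup>T"
    and dims: "\<forall>\<^sub>F x in F. dA x \<in> carrier_mat n n" "\<forall>\<^sub>F x in F. dB x \<in> carrier_mat n m"
    and bigo: "(\<lambda>x. frob (dA x)) \<in> O[F](s)" "(\<lambda>x. frob (dB x)) \<in> O[F](s)"
    and s: "(s \<longlongrightarrow> 0) F"
  shows eventually_sylvester_regular:
      "\<forall>\<^sub>F x in F. sylvester_regular (A + dA x) (A + dA x)\<^sup>T" (is ?regular)
    and gramian_perturbation_bigo: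
      "(\<lambda>x. frob (gramian (A + dA x) (B + dB x) - gramian A B)) \<in> O[F](s)" (is ?bigo)
proof -
  have At: "A\<^sup>T \<in> carrier_mat n n" and dims_At: "\<forall>\<^sub>F x in F. (dA x)\<^sup>T \<in> carrier_mat n n"
    using A dims(1) by simp_all
  have lim: "((\<lambda>x. frob (dA x)) \<longlongrightarrow> 0) F"
    using smalloD_tendsto[OF landau_o.big_small_trans[OF bigo(1)
        smalloI_tendsto[where f = s and g = "\<lambda>_. 1"]]] s by simp
  obtain \<kappa> where "\<forall>\<^sub>F x in F. \<forall>X\<in>carrier_mat n n.
      frob X \<le> \<kappa> * frob (sylvester (A + dA x) (A\<^sup>T + (dA x)\<^sup>T) X)"
    using eventually_sylvester_bounded_below[OF A At regular dims(1) dims_At] lim by auto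
  then have bound: "\<forall>\<^sub>F x in F. \<forall>X\<in>carrier_mat n n.
      frob X \<le> \<kappa> * frob (sylvester (A + dA x) (A + dA x)\<^sup>T X)"
    using dims(1) by eventually_elim (use A in \<open>simp add: transpose_add_dim\<close>)
  then show ?regular
    using dims(1)
    by eventually_elim (use A in \<open>auto intro!: sylvester_regular_if_bounded_below[of _ n _ n]\<close>)
  define P where "P = gramian A B"
  note P = gramian_solution[OF A B regular, folded P_def]
  let ?E = "\<lambda>x. sylvester (dA x) (dA x)\<^sup>T P + (B * (dB x)\<^sup>T + dB x * (B + dB x)\<^sup>T)"
  have "\<forall>\<^sub>F x in F. frob (gramian (A + dA x) (B + dB x) - P) \<le> \<kappa> * frob (?E x)"
    using bound dims \<open>?regular\<close>
  proof eventually_elim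
    case (elim x)
    have carr: "A + dA x \<in> carrier_mat n n" "B + dB x \<in> carrier_mat n m" using A B elim(2,3) by auto
    show ?case
      using elim(1) minus_carrier_mat[OF P(1)]
        gramian_difference_equation[OF A elim(2) B elim(3) P(1,2) gramian_solution(1,2)[OF carr elim(4)]]
      by (metis frob_uminus)
  qed
  then have "(\<lambda>x. frob (gramian (A + dA x) (B + dB x) - P)) \<in> O[F](\<lambda>x. frob (?E x))"
    by (intro bigoI) (auto elim: eventually_mono)
  also have "(\<lambda>x. frob (?E x)) \<in> O[F](s)"
    by (rule gramian_residual_bigo[OF B P(1) dims bigo s])
  finally show ?bigo by (simp add: P_def)
qed

lemma lyapunov_cost_remainder_bigo:
  fixes dA dB dC P' :: "'x \<Rightarrow> real mat"
  assumes P: "P \<in> carrier_mat n n" and Q: "Q \<in> carrier_mat n n" and C: "C \<in> carrier_mat q n"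
    and dims: "\<forall>\<^sub>F x in F. dA x \<in> carrier_mat n n" "\<forall>\<^sub>F x in F. dB x \<in> carrier_mat n m"
      "\<forall>\<^sub>F x in F. dC x \<in> carrier_mat q n" "\<forall>\<^sub>F x in F. P' x \<in> carrier_mat n n"
    and bigo: "(\<lambda>x. frob (dA x)) \<in> O[F](s)" "(\<lambda>x. frob (dB x)) \<in> O[F](s)" "(\<lambda>x. frob (dC x)) \<in> O[F](s)"
      "(\<lambda>x. frob (P' x - P)) \<in> O[F](s)"
    and s: "s \<in> O[F](\<lambda>_. 1)"
  shows "(\<lambda>x. 2 * \<langle>Q * (P' x - P), dA x\<rangle> + 2 * \<langle>C * (P' x - P), dC x\<rangle>
      + \<langle>Q, dB x * (dB x)\<^sup>T\<rangle> + \<langle>(dC x)\<^sup>T * dC x, P' x\<rangle>) \<in> O[F](\<lambda>x. (s x)\<^sup>2)"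
proof -
  have all_dims: "\<forall>\<^sub>F x in F. dA x \<in> carrier_mat n n \<and> dB x \<in> carrier_mat n m \<and>
      dC x \<in> carrier_mat q n \<and> P' x \<in> carrier_mat n n"
    using dims by eventually_elim auto
  have "(\<lambda>x. frob (P + (P' x - P))) \<in> O[F](\<lambda>_. 1)"
    using P landau_o.big_trans[OF bigo(4) s] by (intro frob_add_bigo) auto
  moreover have "\<forall>\<^sub>F x in F. frob (P + (P' x - P)) = frob (P' x)"
    using dims(4) by eventually_elim (use P in \<open>auto intro!: arg_cong[of _ _ frob]\<close>)
  ultimately have "(\<lambda>x. frob (P' x)) \<in> O[F](\<lambda>_. 1)"
    by (simp add: landau_o.big.in_cong)
  moreover have "(\<lambda>x. frob (dB x * (dB x)\<^sup>T)) \<in> O[F](\<lambda>x. s x * s x)"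
    "(\<lambda>x. frob ((dC x)\<^sup>T * dC x)) \<in> O[F](\<lambda>x. s x * s x)"
    using bigo by (intro frob_mult_bigo; simp)+
  moreover have "(\<lambda>x. frob (Q * (P' x - P))) \<in> O[F](s)" "(\<lambda>x. frob (C * (P' x - P))) \<in> O[F](s)"
    using P Q C bigo(4) by (intro frob_const_mult_bigo; simp)+
  ultimately have "(\<lambda>x. \<langle>Q * (P' x - P), dA x\<rangle>) \<in> O[F](\<lambda>x. s x * s x)"
    "(\<lambda>x. \<langle>C * (P' x - P), dC x\<rangle>) \<in> O[F](\<lambda>x. s x * s x)"
    "(\<lambda>x. \<langle>Q, dB x * (dB x)\<^sup>T\<rangle>) \<in> O[F](\<lambda>x. 1 * (s x * s x))"
    "(\<lambda>x. \<langle>(dC x)\<^sup>T * dC x, P' x\<rangle>) \<in> O[F](\<lambda>x. (s x * s x) * 1)"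
    using all_dims P Q C bigo by (intro frob_inner_bigo; auto elim: eventually_mono)+
  then show ?thesis
    by (intro sum_in_bigo) (simp_all add: power2_eq_square)
qed

definition h2_cost_deriv :: "real mat \<Rightarrow> real mat \<Rightarrow> real mat \<Rightarrow> real mat \<Rightarrow> real mat \<Rightarrow> real mat \<Rightarrow> real" where
  "h2_cost_deriv A B C dA dB dC = (let P = gramian A B; Q = gramian A\<^sup>T C\<^sup>T in
     2 * (\<langle>Q * P, dA\<rangle> + \<langle>Q * B, dB\<rangle> + \<langle>C * P, dC\<rangle>))"

text \<open>Envelope formula: the derivative of the Gramian does not enter the first-order change of the
  cost.\<close>

lemma h2_cost_expansion:
  fixes dA dB dC :: "'x \<Rightarrow> real mat"
  assumes "hurwitz A" and A: "A \<in> carrier_mat n n" and B: "B \<in> carrier_mat n m" and C: "C \<in> carrier_mat q n"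
    and dims: "\<forall>\<^sub>F x in F. dA x \<in> carrier_mat n n" "\<forall>\<^sub>F x in F. dB x \<in> carrier_mat n m"
      "\<forall>\<^sub>F x in F. dC x \<in> carrier_mat q n"
    and bigo: "(\<lambda>x. frob (dA x)) \<in> O[F](s)" "(\<lambda>x. frob (dB x)) \<in> O[F](s)" "(\<lambda>x. frob (dC x)) \<in> O[F](s)"
    and s: "(s \<longlongrightarrow> 0) F"
  shows "(\<lambda>x. h2_cost (A + dA x) (B + dB x) (C + dC x) - h2_cost A B C
      - h2_cost_deriv A B C (dA x) (dB x) (dC x)) \<in> O[F](\<lambda>x. (s x)\<^sup>2)"
proof -
  have regular: "sylvester_regular A A\<^sup>T" "sylvester_regular A\<^sup>T A\<^sup>T\<^sup>T"
    using \<open>hurwitz A\<close> by (simp_all add: hurwitz_imp_sylvester_regular hurwitz_transpose)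
  have AtCt: "A\<^sup>T \<in> carrier_mat n n" "C\<^sup>T \<in> carrier_mat n q" using A C by auto
  define P Q where "P = gramian A B" and "Q = gramian A\<^sup>T C\<^sup>T"
  define P' where "P' x = gramian (A + dA x) (B + dB x)" for x
  note P = gramian_solution[OF A B regular(1), folded P_def]
    and Q = gramian_solution[OF AtCt regular(2), folded Q_def, unfolded transpose_transpose]
  note regular' = eventually_sylvester_regular[OF A B regular(1) dims(1,2) bigo(1,2) s]
  have dims': "\<forall>\<^sub>F x in F. P' x \<in> carrier_mat n n"
    using regular' dims(1,2)
    by eventually_elim (use A B in \<open>auto simp: P'_def intro!: gramian_carrier\<close>)
  have "\<forall>\<^sub>F x in F. h2_cost (A + dA x) (B + dB x) (C + dC x) - h2_cost A B C
      - h2_cost_deriv A B C (dA x) (dB x) (dC x)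
      = 2 * \<langle>Q * (P' x - P), dA x\<rangle> + 2 * \<langle>C * (P' x - P), dC x\<rangle>
        + \<langle>Q, dB x * (dB x)\<^sup>T\<rangle> + \<langle>(dC x)\<^sup>T * dC x, P' x\<rangle>"
    using regular' dims dims'
  proof eventually_elim
    case (elim x)
    have "A + dA x \<in> carrier_mat n n" "B + dB x \<in> carrier_mat n m" and C': "C + dC x \<in> carrier_mat q n"
      using A B C elim(2-4) by auto
    note P' = gramian_solution[OF this(1,2) elim(1), folded P'_def]
    show ?case
      using lyapunov_cost_expansion[OF A elim(2) B elim(3) C elim(4) P(1,2) Q P']
        mtrace_congruence[OF elim(5) C'] mtrace_congruence[OF P(1) C]
      by (simp add: h2_cost_def h2_cost_deriv_def Let_def flip: P_def Q_def P'_def)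
  qed
  moreover note lyapunov_cost_remainder_bigo[OF P(1) Q(1) C dims dims' bigo
      gramian_perturbation_bigo[OF A B regular(1) dims(1,2) bigo(1,2) s, folded P_def P'_def]
      bigoI_tendsto[of s "\<lambda>_. 1" 0 F]]
  ultimately show ?thesis using s by (simp add: landau_o.big.in_cong)
qed

subsection \<open>Block matrices\<close>

lemma vcat_dim [simp]: "dim_row (vcat X Y) = dim_row X + dim_row Y" "dim_col (vcat X Y) = dim_col X"
  by (simp_all add: vcat_def)

lemma hcat_dim [simp]: "dim_row (hcat X Y) = dim_row X" "dim_col (hcat X Y) = dim_col X + dim_col Y"
  by (simp_all add: hcat_def)

lemma blockdiag_dim [simp]:
  "dim_row (blockdiag X Y) = dim_row X + dim_row Y" "dim_col (blockdiag X Y) = dim_col X + dim_col Y"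
  by (simp_all add: blockdiag_def)

lemma blk_dim [simp]: "dim_row (blk X n j k) = n" "dim_col (blk X n j k) = n"
  by (simp_all add: blk_def)

lemma vcat_add:
  "dim_row X = dim_row X' \<Longrightarrow> dim_row Y = dim_row Y' \<Longrightarrow> dim_col X = dim_col X' \<Longrightarrow> dim_col Y = dim_col X' \<Longrightarrow>
   dim_col Y' = dim_col X' \<Longrightarrow> vcat (X + X') (Y + Y') = vcat X Y + vcat X' Y'"
  by (rule eq_matI) (auto simp: vcat_def)

lemma hcat_add:
  "dim_row X = dim_row X' \<Longrightarrow> dim_row Y = dim_row X' \<Longrightarrow> dim_row Y' = dim_row X' \<Longrightarrow> dim_col X = dim_col X' \<Longrightarrow>
   dim_col Y = dim_col Y' \<Longrightarrow> hcat (X + X') (Y + Y') = hcat X Y + hcat X' Y'"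
  by (rule eq_matI) (auto simp: hcat_def)

lemma transpose_vcat: "dim_col X = dim_col Y \<Longrightarrow> (vcat X Y)\<^sup>T = hcat X\<^sup>T Y\<^sup>T"
  by (rule eq_matI) (auto simp: vcat_def hcat_def)

lemma vcat_mult: "dim_col X = dim_row Z \<Longrightarrow> dim_col Y = dim_row Z \<Longrightarrow> vcat X Y * Z = vcat (X * Z) (Y * Z)"
  by (rule eq_matI) (auto simp: vcat_def index_mult_mat_sum simp del: index_mult_mat(1))

lemma mult_hcat: "dim_row X = dim_col Z \<Longrightarrow> dim_row Y = dim_col Z \<Longrightarrow> Z * hcat X Y = hcat (Z * X) (Z * Y)"
  by (rule eq_matI) (auto simp: hcat_def index_mult_mat_sum simp del: index_mult_mat(1))

lemma hcat_mult_vcat: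
  assumes "dim_col X = dim_row X'" "dim_col Y = dim_row Y'"
    and "dim_row X = dim_row Y" "dim_col X' = dim_col Y'"
  shows "hcat X Y * vcat X' Y' = X * X' + Y * Y'"
proof (rule eq_matI)
  fix i j assume "i < dim_row (X * X' + Y * Y')" "j < dim_col (X * X' + Y * Y')"
  then have ij: "i < dim_row Y" "j < dim_col Y'" by auto
  let ?a = "dim_row X'" and ?b = "dim_row Y'"
  have split_sum: "(\<Sum>k<a + b. if k < a then f k else g (k - a)) = (\<Sum>k<a. f k) + (\<Sum>k<b. g k)"
    for a b :: nat and f g :: "nat \<Rightarrow> real"
    by (induction b) (simp_all add: add.assoc)
  have "(hcat X Y * vcat X' Y') $$ (i,j) =
      (\<Sum>k<?a + ?b. if k < ?a then X $$ (i,k) * X' $$ (k,j) else Y $$ (i, k - ?a) * Y' $$ (k - ?a, j))"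
    using assms ij by (subst index_mult_mat_sum) (auto simp: hcat_def vcat_def intro!: sum.cong)
  also have "\<dots> = (\<Sum>k<?a. X $$ (i,k) * X' $$ (k,j)) + (\<Sum>k<?b. Y $$ (i,k) * Y' $$ (k,j))"
    by (rule split_sum)
  finally show "(hcat X Y * vcat X' Y') $$ (i,j) = (X * X' + Y * Y') $$ (i,j)"
    using assms ij by (simp add: index_mult_mat_sum del: index_mult_mat(1))
qed (use assms in auto)

lemma blk_decomposition:
  "X \<in> carrier_mat (2 * n) (2 * n) \<Longrightarrow>
   X = vcat (hcat (blk X n 1 1) (blk X n 1 2)) (hcat (blk X n 2 1) (blk X n 2 2))"
  by (rule eq_matI) (auto simp: vcat_def hcat_def blk_def)

lemma blk_transpose:
  "X \<in> carrier_mat (2 * n) (2 * n) \<Longrightarrow> j \<in> {1,2} \<Longrightarrow> k \<in> {1,2} \<Longrightarrow> (blk X n j k)\<^sup>T = blk X\<^sup>T n k j"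
  by (rule eq_matI) (auto simp: blk_def)

lemma transpose_blockdiag:
  "X \<in> carrier_mat k k \<Longrightarrow> Y \<in> carrier_mat l l \<Longrightarrow> (blockdiag X Y)\<^sup>T = blockdiag X\<^sup>T Y\<^sup>T"
  by (rule eq_matI) (auto simp: blockdiag_def vcat_def hcat_def)

lemma uminus_blockdiag:
  "X \<in> carrier_mat k k \<Longrightarrow> Y \<in> carrier_mat l l \<Longrightarrow> - blockdiag X Y = blockdiag (- X) (- Y)"
  by (rule eq_matI) (auto simp: blockdiag_def vcat_def hcat_def)

lemma frob_inner_vcat:
  assumes "dim_row X = dim_row X'" "dim_row Y = dim_row Y'"
    and "dim_col X = dim_col X'" "dim_col Y = dim_col X'" "dim_col Y' = dim_col X'"
  shows "\<langle>vcat X Y, vcat X' Y'\<rangle> = \<langle>X, X'\<rangle> + \<langle>Y, Y'\<rangle>"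
  using assms
  by (simp add: frob_inner_def transpose_vcat hcat_mult_vcat mtrace_def sum.distrib del: index_mult_mat(1))

lemma frob_inner_hcat:
  assumes "dim_col X = dim_col X'" "dim_col Y = dim_col Y'"
    and "dim_row X = dim_row X'" "dim_row Y = dim_row X'" "dim_row Y' = dim_row X'"
  shows "\<langle>hcat X Y, hcat X' Y'\<rangle> = \<langle>X, X'\<rangle> + \<langle>Y, Y'\<rangle>"
  using assms frob_inner_vcat[of "X\<^sup>T" "X'\<^sup>T" "Y\<^sup>T" "Y'\<^sup>T"]
    transpose_vcat[of "X\<^sup>T" "Y\<^sup>T"] transpose_vcat[of "X'\<^sup>T" "Y'\<^sup>T"]
    frob_inner_transpose[of "vcat X\<^sup>T Y\<^sup>T" "vcat X'\<^sup>T Y'\<^sup>T"]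
  by (simp add: frob_inner_transpose)

lemma frob_inner_blocks:
  assumes "H \<in> carrier_mat (2 * n) (2 * n)"
    and "X11 \<in> carrier_mat n n" "X12 \<in> carrier_mat n n" "X21 \<in> carrier_mat n n" "X22 \<in> carrier_mat n n"
  shows "\<langle>H, vcat (hcat X11 X12) (hcat X21 X22)\<rangle> =
    \<langle>blk H n 1 1, X11\<rangle> + \<langle>blk H n 1 2, X12\<rangle> + \<langle>blk H n 2 1, X21\<rangle> + \<langle>blk H n 2 2, X22\<rangle>"
  by (subst blk_decomposition[OF assms(1)]) (use assms in \<open>simp add: frob_inner_vcat frob_inner_hcat\<close>)

lemma frob_vcat_le:
  assumes "dim_col X = dim_col Y"
  shows "frob (vcat X Y) \<le> frob X + frob Y"
proof -
  have "(frob (vcat X Y))\<^sup>2 = (frob X)\<^sup>2 + (frob Y)\<^sup>2"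
    using assms by (simp add: frob_inner_self[symmetric] frob_inner_vcat)
  then have "frob (vcat X Y) = sqrt ((frob X)\<^sup>2 + (frob Y)\<^sup>2)"
    by (metis frob_nonneg real_sqrt_unique)
  then show ?thesis by (simp add: sqrt_sum_squares_le_sum)
qed

lemma frob_vcat_bigo:
  assumes "\<forall>\<^sub>F x in F. dim_col (X x) = dim_col (Y x)"
    and "(\<lambda>x. frob (X x)) \<in> O[F](g)" "(\<lambda>x. frob (Y x)) \<in> O[F](g)"
  shows "(\<lambda>x. frob (vcat (X x) (Y x))) \<in> O[F](g)"
proof -
  have "(\<lambda>x. frob (vcat (X x) (Y x))) \<in> O[F](\<lambda>x. frob (X x) + frob (Y x))"
    using assms(1) by (intro landau_o.big_mono) (auto elim!: eventually_mono intro: frob_vcat_le)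
  also have "(\<lambda>x. frob (X x) + frob (Y x)) \<in> O[F](g)"
    by (intro sum_in_bigo assms)
  finally show ?thesis .
qed

lemma frob_hcat_bigo:
  assumes "\<forall>\<^sub>F x in F. dim_row (X x) = dim_row (Y x)"
    and "(\<lambda>x. frob (X x)) \<in> O[F](g)" "(\<lambda>x. frob (Y x)) \<in> O[F](g)"
  shows "(\<lambda>x. frob (hcat (X x) (Y x))) \<in> O[F](g)"
proof -
  have "(\<lambda>x. frob (vcat (X x)\<^sup>T (Y x)\<^sup>T)) \<in> O[F](g)"
    using assms by (intro frob_vcat_bigo) simp_all
  moreover have "\<forall>\<^sub>F x in F. frob (hcat (X x) (Y x)) = frob (vcat (X x)\<^sup>T (Y x)\<^sup>T)"
    using assms(1)
  proof eventually_elim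
    case (elim x)
    then show ?case
      using transpose_vcat[of "(X x)\<^sup>T" "(Y x)\<^sup>T"] frob_transpose[of "vcat (X x)\<^sup>T (Y x)\<^sup>T"] by simp
  qed
  ultimately show ?thesis by (simp add: landau_o.big.in_cong)
qed

subsection \<open>Skew-symmetric matrices\<close>

definition skew_part :: "real mat \<Rightarrow> real mat" where
  "skew_part M = (1/2) \<cdot>\<^sub>m (M - M\<^sup>T)"

lemma skew_part_dim [simp]:
  "dim_row (skew_part M) = dim_col M" "dim_col (skew_part M) = dim_row M"
  by (simp_all add: skew_part_def)

lemma skew_part_eq_self: "M\<^sup>T = - M \<Longrightarrow> skew_part M = M"
  by (rule eq_matI) (auto simp: skew_part_def)

lemma skew_congruence:
  fixes M S :: "real mat"
  assumes "M \<in> carrier_mat n n" "S \<in> carrier_mat m n" "M\<^sup>T = - M"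
  shows "(S * M * S\<^sup>T)\<^sup>T = - (S * M * S\<^sup>T)"
  using assms by (simp add: transpose_mult_dim assoc_mult_mat_dim)

lemma skew_orthogonal_congruence_iff:
  fixes M S :: "real mat"
  assumes M: "M \<in> carrier_mat n n" and S: "S \<in> carrier_mat n n" "S\<^sup>T * S = 1\<^sub>m n"
  shows "(S * M * S\<^sup>T)\<^sup>T = - (S * M * S\<^sup>T) \<longleftrightarrow> M\<^sup>T = - M"
proof
  assume "(S * M * S\<^sup>T)\<^sup>T = - (S * M * S\<^sup>T)"
  moreover have "S\<^sup>T * (S * M * S\<^sup>T) * S = (S\<^sup>T * S) * M * (S\<^sup>T * S)"
    using M S(1) by (simp add: assoc_mult_mat_dim del: assoc_mult_mat)
  ultimately show "M\<^sup>T = - M"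
    using M S skew_congruence[of "S * M * S\<^sup>T" n "S\<^sup>T" n] by simp
qed (use M S(1) in \<open>rule skew_congruence\<close>)

lemma canonJ_dim [simp]: "dim_row (canonJ k) = k" "dim_col (canonJ k) = k"
  by (simp_all add: canonJ_def)

lemma canonJ_transpose: "(canonJ k)\<^sup>T = - canonJ k"
  by (rule eq_matI) (auto simp: canonJ_def)

lemma canonJ_square:
  assumes "even k"
  shows "canonJ k * canonJ k = - 1\<^sub>m k"
proof (rule eq_matI)
  fix i j assume "i < dim_row (- 1\<^sub>m k :: real mat)" "j < dim_col (- 1\<^sub>m k :: real mat)"
  then have ij: "i < k" "j < k" by auto
  define partner where "partner = (if even i then i + 1 else i - 1)"
  have partner: "partner < k" using ij assms by (auto simp: partner_def) (metis Suc_lessI even_Suc)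
  have "(canonJ k * canonJ k) $$ (i,j) = (\<Sum>l<k. canonJ k $$ (i,l) * canonJ k $$ (l,j))"
    using ij by (subst index_mult_mat_sum) auto
  also have "\<dots> = (\<Sum>l<k. if l = partner then canonJ k $$ (i,partner) * canonJ k $$ (partner,j) else 0)"
    using ij by (intro sum.cong refl) (auto simp: canonJ_def partner_def)
  also have "\<dots> = canonJ k $$ (i,partner) * canonJ k $$ (partner,j)"
    using partner by simp
  also have "\<dots> = (- 1\<^sub>m k) $$ (i,j)"
    using ij partner by (auto simp: canonJ_def partner_def elim!: oddE)
  finally show "(canonJ k * canonJ k) $$ (i,j) = (- 1\<^sub>m k) $$ (i,j)" .
qed auto

subsection \<open>The closed-loop cost\<close>

lemma frob_inner_mult_transpose_mult:
  assumes "M \<in> carrier_mat r n" "K \<in> carrier_mat r s" "X \<in> carrier_mat n s" "J \<in> carrier_mat n n"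
  shows "\<langle>M, K * X\<^sup>T * J\<rangle> = \<langle>J * M\<^sup>T * K, X\<rangle>"
proof -
  have "\<langle>M, K * X\<^sup>T * J\<rangle> = \<langle>K\<^sup>T * (M * J\<^sup>T), X\<^sup>T\<rangle>"
    using assms
    by (subst frob_inner_mult_right_adjoint, simp_all, subst frob_inner_mult_left_adjoint) simp_all
  also have "\<dots> = \<langle>(K\<^sup>T * (M * J\<^sup>T))\<^sup>T, X\<rangle>"
    using assms by (subst frob_inner_transpose[symmetric]) simp_all
  also have "(K\<^sup>T * (M * J\<^sup>T))\<^sup>T = J * M\<^sup>T * K"
    using assms by (simp add: transpose_mult_dim assoc_mult_mat_dim)
  finally show ?thesis .
qed

locale plant_dims =
  fixes G :: plant and n m1 m2 p p0 :: nat
  assumes n_even: "even n"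
    and plant_carrier [simp]: "pA G \<in> carrier_mat n n"
      "pB1 G \<in> carrier_mat n m1" "pB2 G \<in> carrier_mat n m2"
      "pC G \<in> carrier_mat p n" "pD G \<in> carrier_mat p m1"
      "pC0 G \<in> carrier_mat p0 n" "pD0 G \<in> carrier_mat p0 m2"
begin

lemmas plant_dim [simp] = plant_carrier[THEN carrier_matD(1)] plant_carrier[THEN carrier_matD(2)]

lemma J_dim [simp]:
  "dim_row (J0 G) = n" "dim_col (J0 G) = n" "dim_row (J1 G) = m1" "dim_col (J1 G) = m1"
  "dim_row (J2 G) = m2" "dim_col (J2 G) = m2"
  by (simp_all add: J0_def J1_def J2_def)

lemma J0_carrier [simp]: "J0 G \<in> carrier_mat n n"
  by (rule carrier_matI) simp_all

lemma J_transpose: "(J0 G)\<^sup>T = - J0 G" "(J1 G)\<^sup>T = - J1 G" "(J2 G)\<^sup>T = - J2 G"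
  by (simp_all add: J0_def J1_def J2_def canonJ_transpose)

lemma J0_square: "J0 G * J0 G = - 1\<^sub>m n"
  using n_even by (simp add: J0_def canonJ_square)

lemma derived_dim [simp]:
  "dim_row (bigJ G) = m2 + p" "dim_col (bigJ G) = m2 + p"
  "dim_row (bfI G) = m2 + p" "dim_col (bfI G) = m2"
  "dim_row (bfC G) = m2 + p" "dim_col (bfC G) = n"
  "dim_row (bfD G) = m2 + p" "dim_col (bfD G) = m1 + m2"
  "dim_row (Bcat G) = n" "dim_col (Bcat G) = m1 + m2"
  by (simp_all add: bigJ_def bfI_def bfC_def bfD_def Bcat_def)

lemma bigJ_transpose: "(bigJ G)\<^sup>T = - bigJ G"
proof -
  have J2: "J2 G \<in> carrier_mat m2 m2" and DJD: "pD G * J1 G * (pD G)\<^sup>T \<in> carrier_mat p p"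
    by (auto intro!: carrier_matI)
  have "(pD G * J1 G * (pD G)\<^sup>T)\<^sup>T = - (pD G * J1 G * (pD G)\<^sup>T)"
    using skew_congruence[of "J1 G" m1 "pD G" p] by (simp add: J_transpose carrier_matI)
  then show ?thesis
    by (simp add: bigJ_def transpose_blockdiag[OF J2 DJD] uminus_blockdiag[OF J2 DJD] J_transpose)
qed

lemma closed_loop_dim [simp]:
  "dim_row (ctrl_c G b) = m2" "dim_col (ctrl_c G b) = n"
  "dim_row (ctrl_a G R b) = dim_row b" "dim_col (ctrl_a G R b) = n"
  "dim_row (clA G R b) = n + dim_row b" "dim_col (clA G R b) = n + n"
  "dim_row (clB G b) = n + dim_row b" "dim_col (clB G b) = m1 + m2"
  "dim_row (clC G b) = p0" "dim_col (clC G b) = n + n"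
  by (simp_all add: ctrl_c_def ctrl_a_def clA_def clB_def clC_def)

lemma closed_loop_carrier:
  assumes "b \<in> carrier_mat n (m2 + p)"
  shows "clA G R b \<in> carrier_mat (2 * n) (2 * n)" "clB G b \<in> carrier_mat (2 * n) (m1 + m2)"
    "clC G b \<in> carrier_mat p0 (2 * n)"
  using assms by (auto intro!: carrier_matI)

lemma
  assumes "b \<in> carrier_mat n (m2 + p)"
  shows gramP_eq_gramian: "gramP G R b = gramian (clA G R b) (clB G b)"
    and gramQ_eq_gramian: "gramQ G R b = gramian (clA G R b)\<^sup>T (clC G b)\<^sup>T"
    and costE_eq_h2_cost: "costE G R b = h2_cost (clA G R b) (clB G b) (clC G b)"
  using assms by (simp_all add: gramP_def gramQ_def gramian_def costE_def h2_cost_def mult_2)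

lemma
  assumes b: "b \<in> carrier_mat n (m2 + p)" and "hurwitz (clA G R b)"
  shows gramP_carrier: "gramP G R b \<in> carrier_mat (2 * n) (2 * n)"
    and gramP_symmetric: "(gramP G R b)\<^sup>T = gramP G R b"
    and gramQ_carrier: "gramQ G R b \<in> carrier_mat (2 * n) (2 * n)"
proof -
  have regular: "sylvester_regular (clA G R b) (clA G R b)\<^sup>T"
    "sylvester_regular (clA G R b)\<^sup>T (clA G R b)\<^sup>T\<^sup>T"
    using assms by (simp_all add: hurwitz_imp_sylvester_regular hurwitz_transpose)
  note cl = closed_loop_carrier[OF b]
  show "gramP G R b \<in> carrier_mat (2 * n) (2 * n)" "(gramP G R b)\<^sup>T = gramP G R b"
    unfolding gramP_eq_gramian[OF b]
    by (rule gramian_carrier[OF cl(1,2) regular(1)] gramian_symmetric[OF cl(1,2) regular(1)])+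
  show "gramQ G R b \<in> carrier_mat (2 * n) (2 * n)"
    unfolding gramQ_eq_gramian[OF b] using cl
    by (intro gramian_carrier[OF _ _ regular(2)]) auto
qed

abbreviation H_block :: "real mat \<Rightarrow> real mat \<Rightarrow> nat \<Rightarrow> nat \<Rightarrow> real mat" where
  "H_block R b \<equiv> blk (gramQ G R b * gramP G R b) n"

lemma h2_cost_deriv_closed_loop:
  assumes "b \<in> carrier_mat n (m2 + p)"
  shows "h2_cost_deriv (clA G R b) (clB G b) (clC G b) dA dB dC =
    2 * (\<langle>gramQ G R b * gramP G R b, dA\<rangle> + \<langle>gramQ G R b * clB G b, dB\<rangle> + \<langle>clC G b * gramP G R b, dC\<rangle>)"
  by (simp add: h2_cost_deriv_def Let_def gramP_eq_gramian[OF assms] gramQ_eq_gramian[OF assms])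

lemma costE_expansion:
  fixes R' b' dA dB dC :: "'x \<Rightarrow> real mat"
  assumes b: "b \<in> carrier_mat n (m2 + p)" "\<forall>\<^sub>F x in F. b' x \<in> carrier_mat n (m2 + p)"
    and hw: "hurwitz (clA G R b)"
    and dims: "\<forall>\<^sub>F x in F. dA x \<in> carrier_mat (2 * n) (2 * n)"
      "\<forall>\<^sub>F x in F. dB x \<in> carrier_mat (2 * n) (m1 + m2)" "\<forall>\<^sub>F x in F. dC x \<in> carrier_mat p0 (2 * n)"
    and increments: "\<forall>\<^sub>F x in F. clA G (R' x) (b' x) = clA G R b + dA x \<and>
      clB G (b' x) = clB G b + dB x \<and> clC G (b' x) = clC G b + dC x"
    and bigo: "(\<lambda>x. frob (dA x)) \<in> O[F](s)" "(\<lambda>x. frob (dB x)) \<in> O[F](s)" "(\<lambda>x. frob (dC x)) \<in> O[F](s)"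
    and s: "(s \<longlongrightarrow> 0) F"
  shows "(\<lambda>x. costE G (R' x) (b' x) - costE G R b
      - h2_cost_deriv (clA G R b) (clB G b) (clC G b) (dA x) (dB x) (dC x)) \<in> O[F](\<lambda>x. (s x)\<^sup>2)"
  by (rule landau_o.big.in_cong[THEN iffD1, OF _
        h2_cost_expansion[OF hw closed_loop_carrier[OF b(1)] dims bigo s]])
    (use b(2) increments in \<open>eventually_elim; simp add: costE_eq_h2_cost b(1)\<close>)

subsection \<open>First-order condition in \<open>R\<close>\<close>

lemma clA_add_R:
  assumes "b \<in> carrier_mat n (m2 + p)" "R \<in> carrier_mat n n" "X \<in> carrier_mat n n"
  shows "clA G (R + X) b = clA G R b + vcat (hcat (0\<^sub>m n n) (0\<^sub>m n n)) (hcat (0\<^sub>m n n) (J0 G * X))"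
proof -
  note [simp] = assms assms[THEN carrier_matD(1)] assms[THEN carrier_matD(2)]
  have "ctrl_a G (R + X) b = ctrl_a G R b + J0 G * X"
    by (rule eq_matI)
      (simp_all add: ctrl_a_def mult_add_distrib_mat_dim del: index_mult_mat(1) assoc_mult_mat)
  then have "clA G (R + X) b = vcat (hcat (pA G + 0\<^sub>m n n) (pB2 G * ctrl_c G b + 0\<^sub>m n n))
      (hcat (b * bfC G + 0\<^sub>m n n) (ctrl_a G R b + J0 G * X))"
    by (simp add: clA_def right_add_zero_mat_dim)
  then show ?thesis
    by (simp add: vcat_add hcat_add clA_def del: right_add_zero_mat)
qed

lemma h2_cost_deriv_R:
  assumes b: "b \<in> carrier_mat n (m2 + p)" and hw: "hurwitz (clA G R b)" and X: "X \<in> carrier_mat n n"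
  shows "h2_cost_deriv (clA G R b) (clB G b) (clC G b)
      (vcat (hcat (0\<^sub>m n n) (0\<^sub>m n n)) (hcat (0\<^sub>m n n) (J0 G * X))) (0\<^sub>m (2 * n) (m1 + m2)) (0\<^sub>m p0 (2 * n))
    = 2 * \<langle>(J0 G)\<^sup>T * H_block R b 2 2, X\<rangle>"
proof -
  note P = gramP_carrier[OF b hw] and Q = gramQ_carrier[OF b hw]
  have "\<langle>gramQ G R b * gramP G R b, vcat (hcat (0\<^sub>m n n) (0\<^sub>m n n)) (hcat (0\<^sub>m n n) (J0 G * X))\<rangle>
      = \<langle>H_block R b 2 2, J0 G * X\<rangle>"
    using P Q X
    by (subst frob_inner_blocks) (auto simp: frob_inner_zero_right[of "blk _ n _ _", simplified])
  also have "\<dots> = \<langle>(J0 G)\<^sup>T * H_block R b 2 2, X\<rangle>"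
    using X by (subst frob_inner_mult_left_adjoint) auto
  finally show ?thesis
    using P Q frob_inner_zero_right[of "gramQ G R b * clB G b"]
      frob_inner_zero_right[of "clC G b * gramP G R b"]
    by (simp add: h2_cost_deriv_closed_loop[OF b])
qed

lemma costE_expansion_R:
  assumes b: "b \<in> carrier_mat n (m2 + p)" and R: "R \<in> carrier_mat n n" and hw: "hurwitz (clA G R b)"
    and S: "S \<subseteq> carrier_mat n n"
  shows "(\<lambda>X. costE G (R + X) b - costE G R b - 2 * \<langle>(J0 G)\<^sup>T * H_block R b 2 2, X\<rangle>)
    \<in> O[near_zero S](\<lambda>X. (frob X)\<^sup>2)"
proof -
  let ?dA = "\<lambda>X. vcat (hcat (0\<^sub>m n n) (0\<^sub>m n n)) (hcat (0\<^sub>m n n) (J0 G * X))"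
    and ?dB = "0\<^sub>m (2 * n) (m1 + m2)" and ?dC = "0\<^sub>m p0 (2 * n)"
  have dims: "\<forall>\<^sub>F X in near_zero S. X \<in> carrier_mat n n"
    using eventually_near_zero_in[of S] S by (auto elim: eventually_mono)
  have bigo: "(\<lambda>X. frob (?dA X)) \<in> O[near_zero S](frob)"
    using dims by (intro frob_vcat_bigo frob_hcat_bigo frob_const_mult_bigo) (auto elim: eventually_mono)
  have increments: "\<forall>\<^sub>F X in near_zero S. clA G (R + X) b = clA G R b + ?dA X \<and>
      clB G b = clB G b + ?dB \<and> clC G b = clC G b + ?dC"
    using dims by eventually_elim (use b R in \<open>simp add: clA_add_R right_add_zero_mat_dim\<close>)
  have "(\<lambda>X. costE G (R + X) b - costE G R b
      - h2_cost_deriv (clA G R b) (clB G b) (clC G b) (?dA X) ?dB ?dC) \<in> O[near_zero S](\<lambda>X. (frob X)\<^sup>2)"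
    using dims b bigo increments by (intro costE_expansion[OF b _ hw] frob_tendsto_near_zero)
      (auto elim: eventually_mono intro!: carrier_matI)
  then show ?thesis
    by (rule landau_o.big.in_cong[THEN iffD1, rotated])
      (use dims in \<open>eventually_elim; simp add: h2_cost_deriv_R[OF b hw]\<close>)
qed

lemma dE_R_zero_iff:
  assumes b: "b \<in> carrier_mat n (m2 + p)" and R: "R \<in> carrier_mat n n" and hw: "hurwitz (clA G R b)"
  shows "dE_R_zero G R b \<longleftrightarrow> (H_block R b 2 2 * J0 G)\<^sup>T = - (H_block R b 2 2 * J0 G)"
proof -
  let ?S = "{X \<in> carrier_mat n n. X\<^sup>T = X}" and ?H22 = "H_block R b 2 2"
  have H22: "?H22 \<in> carrier_mat n n" by (rule carrier_matI) simp_all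
  have JH22: "(J0 G)\<^sup>T * ?H22 \<in> carrier_mat n n" by (rule carrier_matI) simp_all
  have "dE_R_zero G R b \<longleftrightarrow> (\<lambda>X. costE G (R + X) b - costE G R b) \<in> o[near_zero ?S](frob)"
    by (simp add: dE_R_zero_def smallo_near_zero_iff imp_conjL)
  also have "\<dots> \<longleftrightarrow> (\<forall>X\<in>?S. \<langle>(J0 G)\<^sup>T * ?H22, X\<rangle> = 0)"
    using costE_expansion_R[OF b R hw, of ?S]
    by (intro smallo_iff_gradient_orthogonal[where c = 2]) (auto simp: transpose_smult)
  also have "\<dots> \<longleftrightarrow> ((J0 G)\<^sup>T * ?H22)\<^sup>T = - ((J0 G)\<^sup>T * ?H22)"
    by (rule orthogonal_symmetric_iff_skew[OF JH22])
  also have "\<dots> \<longleftrightarrow> (J0 G * ((J0 G)\<^sup>T * ?H22) * (J0 G)\<^sup>T)\<^sup>T = - (J0 G * ((J0 G)\<^sup>T * ?H22) * (J0 G)\<^sup>T)"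
    by (rule skew_orthogonal_congruence_iff[OF JH22, symmetric]) (simp_all add: J_transpose J0_square)
  also have "J0 G * ((J0 G)\<^sup>T * ?H22) * (J0 G)\<^sup>T = - (J0 G * J0 G) * ?H22 * - J0 G"
    using H22 by (simp add: J_transpose assoc_mult_mat_dim)
  also have "\<dots> = - (?H22 * J0 G)"
    using H22 by (simp add: J0_square)
  finally show ?thesis by (simp only: transpose_uminus uminus_eq_mat)
qed

subsection \<open>First-order condition in \<open>b\<close>\<close>

definition ctrl_a_linear :: "real mat \<Rightarrow> real mat \<Rightarrow> real mat" where
  "ctrl_a_linear b X = (1/2) \<cdot>\<^sub>m (X * bigJ G * b\<^sup>T * J0 G + b * bigJ G * X\<^sup>T * J0 G)"

definition ctrl_a_quadratic :: "real mat \<Rightarrow> real mat" where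
  "ctrl_a_quadratic X = (1/2) \<cdot>\<^sub>m (X * bigJ G * X\<^sup>T * J0 G)"

definition clA_increment :: "real mat \<Rightarrow> real mat \<Rightarrow> real mat" where
  "clA_increment b X = vcat (hcat (0\<^sub>m n n) (pB2 G * ctrl_c G X))
     (hcat (X * bfC G) (ctrl_a_linear b X + ctrl_a_quadratic X))"

definition clB_increment :: "real mat \<Rightarrow> real mat" where
  "clB_increment X = vcat (0\<^sub>m n (m1 + m2)) (X * bfD G)"

definition clC_increment :: "real mat \<Rightarrow> real mat" where
  "clC_increment X = hcat (0\<^sub>m p0 n) (pD0 G * ctrl_c G X)"

lemma increment_dim [simp]:
  "dim_row (ctrl_a_linear b X) = dim_row b" "dim_col (ctrl_a_linear b X) = n"
  "dim_row (ctrl_a_quadratic X) = dim_row X" "dim_col (ctrl_a_quadratic X) = n"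
  "dim_row (clA_increment b X) = n + dim_row X" "dim_col (clA_increment b X) = n + n"
  "dim_row (clB_increment X) = n + dim_row X" "dim_col (clB_increment X) = m1 + m2"
  "dim_row (clC_increment X) = p0" "dim_col (clC_increment X) = n + n"
  by (simp_all add: ctrl_a_linear_def ctrl_a_quadratic_def clA_increment_def clB_increment_def
      clC_increment_def)

lemma ctrl_c_add:
  assumes "b \<in> carrier_mat n (m2 + p)" "X \<in> carrier_mat n (m2 + p)"
  shows "ctrl_c G (b + X) = ctrl_c G b + ctrl_c G X"
  using assms by (simp add: ctrl_c_def transpose_add_dim mult_add_distrib_mat_dim add_mult_distrib_mat_dim)

lemma ctrl_a_add:
  assumes "b \<in> carrier_mat n (m2 + p)" "X \<in> carrier_mat n (m2 + p)" "R \<in> carrier_mat n n"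
  shows "ctrl_a G R (b + X) = ctrl_a G R b + (ctrl_a_linear b X + ctrl_a_quadratic X)"
  using assms by (intro eq_matI)
    (simp_all add: ctrl_a_def ctrl_a_linear_def ctrl_a_quadratic_def transpose_add_dim
      mult_add_distrib_mat_dim add_mult_distrib_mat_dim field_simps del: index_mult_mat(1) assoc_mult_mat)

lemma closed_loop_add_b:
  assumes "b \<in> carrier_mat n (m2 + p)" "X \<in> carrier_mat n (m2 + p)"
  shows clA_add_b: "R \<in> carrier_mat n n \<Longrightarrow> clA G R (b + X) = clA G R b + clA_increment b X"
    and clB_add: "clB G (b + X) = clB G b + clB_increment X"
    and clC_add: "clC G (b + X) = clC G b + clC_increment X"
proof -
  note [simp] = assms assms[THEN carrier_matD(1)] assms[THEN carrier_matD(2)]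
  show "clA G R (b + X) = clA G R b + clA_increment b X" if "R \<in> carrier_mat n n"
  proof -
    have "clA G R (b + X) = vcat (hcat (pA G + 0\<^sub>m n n) (pB2 G * ctrl_c G b + pB2 G * ctrl_c G X))
        (hcat (b * bfC G + X * bfC G) (ctrl_a G R b + (ctrl_a_linear b X + ctrl_a_quadratic X)))"
      using that
      by (simp add: clA_def ctrl_c_add ctrl_a_add mult_add_distrib_mat_dim add_mult_distrib_mat_dim
          right_add_zero_mat_dim)
    then show ?thesis
      by (simp add: vcat_add hcat_add clA_def clA_increment_def del: right_add_zero_mat)
  qed
  have "clB G (b + X) = vcat (Bcat G + 0\<^sub>m n (m1 + m2)) (b * bfD G + X * bfD G)"
    by (simp add: clB_def add_mult_distrib_mat_dim right_add_zero_mat_dim)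
  then show "clB G (b + X) = clB G b + clB_increment X"
    by (simp add: clB_def clB_increment_def vcat_add del: right_add_zero_mat)
  have "clC G (b + X) = hcat (pC0 G + 0\<^sub>m p0 n) (pD0 G * ctrl_c G b + pD0 G * ctrl_c G X)"
    by (simp add: clC_def ctrl_c_add mult_add_distrib_mat_dim right_add_zero_mat_dim)
  then show "clC G (b + X) = clC G b + clC_increment X"
    by (simp add: clC_def clC_increment_def hcat_add del: right_add_zero_mat)
qed

lemma increment_bigo:
  assumes b: "b \<in> carrier_mat n (m2 + p)" and dims: "\<forall>\<^sub>F X in F. X \<in> carrier_mat n (m2 + p)"
    and lim: "(frob \<longlongrightarrow> 0) F"
  shows ctrl_a_quadratic_bigo: "(\<lambda>X. frob (ctrl_a_quadratic X)) \<in> O[F](\<lambda>X. (frob X)\<^sup>2)"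
    and clA_increment_bigo: "(\<lambda>X. frob (clA_increment b X)) \<in> O[F](frob)"
    and clB_increment_bigo: "(\<lambda>X. frob (clB_increment X)) \<in> O[F](frob)"
    and clC_increment_bigo: "(\<lambda>X. frob (clC_increment X)) \<in> O[F](frob)"
proof -
  have "(\<lambda>X. frob (X * bigJ G * X\<^sup>T * J0 G)) \<in> O[F](\<lambda>X. frob X * frob X)"
    using dims by (intro frob_mult_const_bigo frob_mult_bigo) (auto elim: eventually_mono)
  then show quadratic: "(\<lambda>X. frob (ctrl_a_quadratic X)) \<in> O[F](\<lambda>X. (frob X)\<^sup>2)"
    by (simp add: ctrl_a_quadratic_def frob_smult power2_eq_square)
  have "frob \<in> O[F](\<lambda>_. 1)"
    using bigoI_tendsto[of frob "\<lambda>_. 1" 0 F] lim by simp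
  then have "(\<lambda>X. (frob X)\<^sup>2) \<in> O[F](frob)"
    using landau_o.big_mult[of frob F "\<lambda>_. 1" frob frob] by (simp add: power2_eq_square)
  then have quadratic': "(\<lambda>X. frob (ctrl_a_quadratic X)) \<in> O[F](frob)"
    by (rule landau_o.big_trans[OF quadratic])
  have linear: "(\<lambda>X. frob (ctrl_a_linear b X)) \<in> O[F](frob)"
    unfolding ctrl_a_linear_def frob_smult using dims b
    by (intro landau_o.big.cmult_in_iff[THEN iffD2] frob_add_bigo frob_mult_const_bigo
        frob_const_mult_bigo)
      (auto elim: eventually_mono)
  have ctrl_c: "(\<lambda>X. frob (ctrl_c G X)) \<in> O[F](frob)"
    unfolding ctrl_c_def using dims
    by (intro frob_mult_const_bigo frob_const_mult_bigo) (auto elim: eventually_mono)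
  show "(\<lambda>X. frob (clA_increment b X)) \<in> O[F](frob)"
    unfolding clA_increment_def using dims b ctrl_c linear quadratic'
    by (intro frob_vcat_bigo frob_hcat_bigo frob_add_bigo frob_const_mult_bigo frob_mult_const_bigo)
      (auto elim: eventually_mono)
  show "(\<lambda>X. frob (clB_increment X)) \<in> O[F](frob)"
    unfolding clB_increment_def using dims
    by (intro frob_vcat_bigo frob_mult_const_bigo) (auto elim: eventually_mono)
  show "(\<lambda>X. frob (clC_increment X)) \<in> O[F](frob)"
    unfolding clC_increment_def using ctrl_c
    by (intro frob_hcat_bigo frob_const_mult_bigo) auto
qed

lemma frob_inner_mult_ctrl_c:
  assumes "M \<in> carrier_mat r n" "K \<in> carrier_mat r m2" "X \<in> carrier_mat n (m2 + p)"
  shows "\<langle>M, K * ctrl_c G X\<rangle> = \<langle>J0 G * M\<^sup>T * K * J2 G * (bfI G)\<^sup>T, X\<rangle>"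
proof -
  have "K * ctrl_c G X = K * (J2 G * (bfI G)\<^sup>T) * X\<^sup>T * J0 G"
    using assms by (simp add: ctrl_c_def assoc_mult_mat_dim)
  moreover have "K * (J2 G * (bfI G)\<^sup>T) \<in> carrier_mat r (m2 + p)"
    using assms by (auto intro!: carrier_matI)
  ultimately have "\<langle>M, K * ctrl_c G X\<rangle> = \<langle>J0 G * M\<^sup>T * (K * (J2 G * (bfI G)\<^sup>T)), X\<rangle>"
    using frob_inner_mult_transpose_mult[OF assms(1) _ assms(3) J0_carrier] by simp
  then show ?thesis
    using assms by (simp add: assoc_mult_mat_dim)
qed

lemma frob_inner_ctrl_a_linear:
  assumes M: "M \<in> carrier_mat n n" and b: "b \<in> carrier_mat n (m2 + p)"
    and X: "X \<in> carrier_mat n (m2 + p)"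
  shows "\<langle>M, ctrl_a_linear b X\<rangle> = \<langle>skew_part (M * J0 G) * b * bigJ G, X\<rangle>"
proof -
  have "\<langle>M, X * bigJ G * b\<^sup>T * J0 G\<rangle> = \<langle>M * (bigJ G * b\<^sup>T * J0 G)\<^sup>T, X\<rangle>"
    using assms frob_inner_mult_right_adjoint[of M X "bigJ G * b\<^sup>T * J0 G"]
    by (simp add: assoc_mult_mat_dim)
  also have "(bigJ G * b\<^sup>T * J0 G)\<^sup>T = J0 G * b * bigJ G"
    using b by (simp add: transpose_mult_dim J_transpose bigJ_transpose assoc_mult_mat_dim)
  finally have left: "\<langle>M, X * bigJ G * b\<^sup>T * J0 G\<rangle> = \<langle>M * J0 G * b * bigJ G, X\<rangle>"
    using assms by (simp add: assoc_mult_mat_dim)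
  have "b * bigJ G \<in> carrier_mat n (m2 + p)"
    using b by (auto intro!: carrier_matI)
  from frob_inner_mult_transpose_mult[OF M this X J0_carrier]
  have right: "\<langle>M, b * bigJ G * X\<^sup>T * J0 G\<rangle> = \<langle>J0 G * M\<^sup>T * b * bigJ G, X\<rangle>"
    using assms by (simp add: assoc_mult_mat_dim)
  have "skew_part (M * J0 G) = (1/2) \<cdot>\<^sub>m (M * J0 G + J0 G * M\<^sup>T)"
    using M by (intro eq_matI)
      (simp_all add: skew_part_def transpose_mult_dim J_transpose del: index_mult_mat(1))
  then show ?thesis
    using assms left right
    by (simp add: ctrl_a_linear_def frob_inner_smult_left frob_inner_smult_right frob_inner_add_left
        frob_inner_add_right smult_mult_dim add_mult_distrib_mat_dim del: assoc_mult_mat)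
qed

lemma frob_inner_clA_increment:
  assumes H: "H \<in> carrier_mat (2 * n) (2 * n)" and b: "b \<in> carrier_mat n (m2 + p)"
    and X: "X \<in> carrier_mat n (m2 + p)"
  shows "\<langle>H, clA_increment b X\<rangle> = \<langle>skew_part (blk H n 2 2 * J0 G) * b * bigJ G, X\<rangle>
    + \<langle>blk H n 2 1 * (bfC G)\<^sup>T, X\<rangle> + \<langle>J0 G * (blk H n 1 2)\<^sup>T * pB2 G * J2 G * (bfI G)\<^sup>T, X\<rangle>
    + \<langle>blk H n 2 2, ctrl_a_quadratic X\<rangle>"
proof -
  have blk: "blk H n j k \<in> carrier_mat n n" for j k by (rule carrier_matI) simp_all
  have "\<langle>H, clA_increment b X\<rangle> = \<langle>blk H n 1 2, pB2 G * ctrl_c G X\<rangle> + \<langle>blk H n 2 1, X * bfC G\<rangle>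
      + (\<langle>blk H n 2 2, ctrl_a_linear b X\<rangle> + \<langle>blk H n 2 2, ctrl_a_quadratic X\<rangle>)"
    unfolding clA_increment_def using X b
    by (subst frob_inner_blocks[OF H])
      (auto simp: frob_inner_add_right frob_inner_zero_right[of "blk _ n _ _", simplified]
        intro!: carrier_matI)
  moreover have "\<langle>blk H n 2 1, X * bfC G\<rangle> = \<langle>blk H n 2 1 * (bfC G)\<^sup>T, X\<rangle>"
    using X by (subst frob_inner_mult_right_adjoint) simp_all
  ultimately show ?thesis
    using frob_inner_mult_ctrl_c[OF blk plant_carrier(3) X] frob_inner_ctrl_a_linear[OF blk b X] by simp
qed

lemma frob_inner_clB_increment:
  assumes Q: "Q \<in> carrier_mat (2 * n) (2 * n)" and b: "b \<in> carrier_mat n (m2 + p)"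
    and X: "X \<in> carrier_mat n (m2 + p)"
  shows "\<langle>Q * clB G b, clB_increment X\<rangle> =
    \<langle>blk Q n 2 1 * Bcat G * (bfD G)\<^sup>T, X\<rangle> + \<langle>blk Q n 2 2 * b * bfD G * (bfD G)\<^sup>T, X\<rangle>"
proof -
  have "Q * clB G b = vcat (blk Q n 1 1 * Bcat G + blk Q n 1 2 * (b * bfD G))
      (blk Q n 2 1 * Bcat G + blk Q n 2 2 * (b * bfD G))"
    using b unfolding clB_def
    by (subst blk_decomposition[OF Q]) (simp add: vcat_mult hcat_mult_vcat)
  then have "\<langle>Q * clB G b, clB_increment X\<rangle>
      = \<langle>blk Q n 2 1 * Bcat G + blk Q n 2 2 * (b * bfD G), X * bfD G\<rangle>"
    using b X frob_inner_zero_right[of "blk Q n 1 1 * Bcat G + blk Q n 1 2 * (b * bfD G)"]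
    by (simp add: clB_increment_def frob_inner_vcat)
  also have "\<dots> = \<langle>(blk Q n 2 1 * Bcat G + blk Q n 2 2 * (b * bfD G)) * (bfD G)\<^sup>T, X\<rangle>"
    using b X by (intro frob_inner_mult_right_adjoint) simp_all
  finally show ?thesis
    using b X by (simp add: add_mult_distrib_mat_dim frob_inner_add_left assoc_mult_mat_dim)
qed

lemma frob_inner_clC_increment:
  assumes P: "P \<in> carrier_mat (2 * n) (2 * n)" "P\<^sup>T = P" and b: "b \<in> carrier_mat n (m2 + p)"
    and X: "X \<in> carrier_mat n (m2 + p)"
  shows "\<langle>clC G b * P, clC_increment X\<rangle> =
    \<langle>J0 G * (blk P n 2 1 * (pC0 G)\<^sup>T * pD0 G) * J2 G * (bfI G)\<^sup>T, X\<rangle>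
    + \<langle>J0 G * blk P n 2 2 * J0 G * b * bfI G * J2 G * (pD0 G)\<^sup>T * pD0 G * J2 G * (bfI G)\<^sup>T, X\<rangle>"
proof -
  let ?M = "pC0 G * blk P n 1 2 + pD0 G * ctrl_c G b * blk P n 2 2"
  have "clC G b * P = hcat (pC0 G * blk P n 1 1 + pD0 G * ctrl_c G b * blk P n 2 1) ?M"
    unfolding clC_def
    by (subst blk_decomposition[OF P(1)]) (simp add: hcat_mult_vcat mult_hcat hcat_add)
  then have "\<langle>clC G b * P, clC_increment X\<rangle> = \<langle>?M, pD0 G * ctrl_c G X\<rangle>"
    using frob_inner_zero_right[of "pC0 G * blk P n 1 1 + pD0 G * ctrl_c G b * blk P n 2 1"]
    by (simp add: clC_increment_def frob_inner_hcat)
  also have "\<dots> = \<langle>J0 G * ?M\<^sup>T * pD0 G * J2 G * (bfI G)\<^sup>T, X\<rangle>"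
    using X by (intro frob_inner_mult_ctrl_c) (auto intro!: carrier_matI)
  also have "?M\<^sup>T = blk P n 2 1 * (pC0 G)\<^sup>T + blk P n 2 2 * (ctrl_c G b)\<^sup>T * (pD0 G)\<^sup>T"
    using blk_transpose[OF P(1), of 1 2] blk_transpose[OF P(1), of 2 2]
    by (simp add: P(2) transpose_add_dim transpose_mult_dim assoc_mult_mat_dim)
  also have "(ctrl_c G b)\<^sup>T = J0 G * b * bfI G * J2 G"
    using b by (simp add: ctrl_c_def transpose_mult_dim J_transpose assoc_mult_mat_dim)
  finally show ?thesis
    using b X
    by (simp add: add_mult_distrib_mat_dim mult_add_distrib_mat_dim frob_inner_add_left assoc_mult_mat_dim)
qed

text \<open>Half the gradient of the cost in \<open>b\<close> when \<open>\<Phi>\<close> is the antisymmetric part of \<open>H\<^sub>2\<^sub>2 J\<^sub>0\<close>.\<close>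

definition half_grad_b :: "real mat \<Rightarrow> real mat \<Rightarrow> real mat \<Rightarrow> real mat" where
  "half_grad_b R b \<Phi> = opM G R b \<Phi> b + H_block R b 2 1 * (bfC G)\<^sup>T
     + blk (gramQ G R b) n 2 1 * Bcat G * (bfD G)\<^sup>T
     + J0 G * ((H_block R b 1 2)\<^sup>T * pB2 G + blk (gramP G R b) n 2 1 * (pC0 G)\<^sup>T * pD0 G)
         * J2 G * (bfI G)\<^sup>T"

lemma half_grad_b_dim [simp]:
  "dim_row (half_grad_b R b \<Phi>) = n" "dim_col (half_grad_b R b \<Phi>) = m2 + p"
  by (simp_all add: half_grad_b_def)

lemma h2_cost_deriv_b:
  assumes b: "b \<in> carrier_mat n (m2 + p)" and X: "X \<in> carrier_mat n (m2 + p)"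
    and hw: "hurwitz (clA G R b)"
  shows "h2_cost_deriv (clA G R b) (clB G b) (clC G b)
      (clA_increment b X) (clB_increment X) (clC_increment X)
    = 2 * \<langle>half_grad_b R b (skew_part (H_block R b 2 2 * J0 G)), X\<rangle>
      + 2 * \<langle>H_block R b 2 2, ctrl_a_quadratic X\<rangle>"
proof -
  note P = gramP_carrier[OF b hw] and Q = gramQ_carrier[OF b hw]
  show ?thesis
    using b X frob_inner_clA_increment[OF mult_carrier_mat[OF Q P] b X]
      frob_inner_clB_increment[OF Q b X] frob_inner_clC_increment[OF P gramP_symmetric[OF b hw] b X]
    by (simp add: h2_cost_deriv_closed_loop half_grad_b_def opM_def Let_def frob_inner_add_left
        mult_add_distrib_mat_dim add_mult_distrib_mat_dim assoc_mult_mat_dim)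
qed

lemma costE_expansion_b:
  assumes b: "b \<in> carrier_mat n (m2 + p)" and R: "R \<in> carrier_mat n n" and hw: "hurwitz (clA G R b)"
  shows "(\<lambda>X. costE G R (b + X) - costE G R b
      - 2 * \<langle>half_grad_b R b (skew_part (H_block R b 2 2 * J0 G)), X\<rangle>)
    \<in> O[near_zero (carrier_mat n (m2 + p))](\<lambda>X. (frob X)\<^sup>2)"
proof -
  let ?F = "near_zero (carrier_mat n (m2 + p))"
  let ?deriv = "\<lambda>X. h2_cost_deriv (clA G R b) (clB G b) (clC G b)
      (clA_increment b X) (clB_increment X) (clC_increment X)"
    and ?quadratic = "\<lambda>X. \<langle>H_block R b 2 2, ctrl_a_quadratic X\<rangle>"
  have dims: "\<forall>\<^sub>F X in ?F. X \<in> carrier_mat n (m2 + p)" by (rule eventually_near_zero_in)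
  note bigo = increment_bigo[OF b dims frob_tendsto_near_zero]
  have increments: "\<forall>\<^sub>F X in ?F. clA G R (b + X) = clA G R b + clA_increment b X \<and>
      clB G (b + X) = clB G b + clB_increment X \<and> clC G (b + X) = clC G b + clC_increment X"
    using dims by eventually_elim (use b R in \<open>simp add: closed_loop_add_b\<close>)
  have expansion: "(\<lambda>X. costE G R (b + X) - costE G R b - ?deriv X) \<in> O[?F](\<lambda>X. (frob X)\<^sup>2)"
    using dims b bigo increments by (intro costE_expansion[OF b _ hw] frob_tendsto_near_zero)
      (auto elim!: eventually_mono intro!: carrier_matI)
  have "?quadratic \<in> O[?F](\<lambda>X. 1 * (frob X)\<^sup>2)"
    using dims bigo(1) by (intro frob_inner_bigo) (auto elim: eventually_mono)
  then have "(\<lambda>X. costE G R (b + X) - costE G R b - ?deriv X + 2 * ?quadratic X) \<in> O[?F](\<lambda>X. (frob X)\<^sup>2)"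
    using sum_in_bigo(1)[OF expansion, of "\<lambda>X. 2 * ?quadratic X"] by simp
  then show ?thesis
    by (rule landau_o.big.in_cong[THEN iffD1, rotated])
      (use dims in \<open>eventually_elim; simp add: h2_cost_deriv_b[OF b _ hw]\<close>)
qed

lemma dE_b_zero_iff:
  assumes b: "b \<in> carrier_mat n (m2 + p)" and R: "R \<in> carrier_mat n n" and hw: "hurwitz (clA G R b)"
  shows "dE_b_zero G R b \<longleftrightarrow> half_grad_b R b (skew_part (H_block R b 2 2 * J0 G)) = 0\<^sub>m n (m2 + p)"
proof -
  let ?S = "carrier_mat n (m2 + p)" and ?D = "half_grad_b R b (skew_part (H_block R b 2 2 * J0 G))"
  have "dE_b_zero G R b \<longleftrightarrow> (\<lambda>X. costE G R (b + X) - costE G R b) \<in> o[near_zero ?S](frob)"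
    by (simp add: dE_b_zero_def smallo_near_zero_iff Ball_def imp_conjL)
  also have "\<dots> \<longleftrightarrow> (\<forall>X\<in>?S. \<langle>?D, X\<rangle> = 0)"
    using costE_expansion_b[OF b R hw] by (intro smallo_iff_gradient_orthogonal[where c = 2]) auto
  also have "\<dots> \<longleftrightarrow> ?D = 0\<^sub>m n (m2 + p)"
    by (rule frob_inner_nondegenerate) (simp add: carrier_matI)
  finally show ?thesis .
qed

lemma eq_uminus_mult_J0_iff:
  assumes "X \<in> carrier_mat n n" "\<Phi> \<in> carrier_mat n n"
  shows "X = - (\<Phi> * J0 G) \<longleftrightarrow> \<Phi> = X * J0 G"
proof
  assume "X = - (\<Phi> * J0 G)"
  then have "X * J0 G = - (\<Phi> * (J0 G * J0 G))" using assms by (simp add: assoc_mult_mat_dim)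
  then show "\<Phi> = X * J0 G" using assms by (simp add: J0_square)
next
  assume "\<Phi> = X * J0 G"
  then have "- (\<Phi> * J0 G) = - (X * (J0 G * J0 G))" using assms by (simp add: assoc_mult_mat_dim)
  then show "X = - (\<Phi> * J0 G)" using assms by (simp add: J0_square)
qed

lemma critical_point_iff:
  assumes b: "b \<in> carrier_mat n (m2 + p)" and R: "R \<in> carrier_mat n n" and hw: "hurwitz (clA G R b)"
  shows "dE_R_zero G R b \<and> dE_b_zero G R b \<longleftrightarrow>
    (\<exists>\<Phi>\<in>carrier_mat n n. \<Phi>\<^sup>T = - \<Phi> \<and> H_block R b 2 2 = - (\<Phi> * J0 G) \<and>
      half_grad_b R b \<Phi> = 0\<^sub>m n (m2 + p))"
proof -
  have H22: "H_block R b 2 2 \<in> carrier_mat n n" by (rule carrier_matI) simp_all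
  define \<Psi> where "\<Psi> = H_block R b 2 2 * J0 G"
  have "dE_R_zero G R b \<and> dE_b_zero G R b \<longleftrightarrow>
      \<Psi>\<^sup>T = - \<Psi> \<and> half_grad_b R b (skew_part \<Psi>) = 0\<^sub>m n (m2 + p)"
    by (simp add: \<Psi>_def dE_R_zero_iff[OF b R hw] dE_b_zero_iff[OF b R hw])
  also have "\<dots> \<longleftrightarrow> \<Psi>\<^sup>T = - \<Psi> \<and> half_grad_b R b \<Psi> = 0\<^sub>m n (m2 + p)"
    using skew_part_eq_self[of \<Psi>] by auto
  also have "\<dots> \<longleftrightarrow> (\<exists>\<Phi>\<in>carrier_mat n n. \<Phi>\<^sup>T = - \<Phi> \<and> H_block R b 2 2 = - (\<Phi> * J0 G) \<and>
      half_grad_b R b \<Phi> = 0\<^sub>m n (m2 + p))"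
    using eq_uminus_mult_J0_iff[OF H22] H22 J0_carrier by (auto simp: \<Psi>_def)
  finally show ?thesis .
qed

end

theorem theorem1:
  fixes G :: plant and n m1 m2 p p0 :: nat and R b :: "real mat"
  assumes "even n" "even m1" "even m2" "0 < n" "0 < m1" "0 < m2" "0 < p" "0 < p0"
    and "pA G \<in> carrier_mat n n" "pB1 G \<in> carrier_mat n m1" "pB2 G \<in> carrier_mat n m2"
    and "pC G \<in> carrier_mat p n" "pD G \<in> carrier_mat p m1"
    and "pC0 G \<in> carrier_mat p0 n" "pD0 G \<in> carrier_mat p0 m2"
    and "R \<in> carrier_mat n n" "transpose_mat R = R"
    and "b \<in> carrier_mat n (m2 + p)"
    and "hurwitz (clA G R b)"
  shows "(dE_R_zero G R b \<and> dE_b_zero G R b) \<longleftrightarrow>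
    (\<exists>\<Phi> \<in> carrier_mat n n. transpose_mat \<Phi> = - \<Phi> \<and>
       (let H = gramQ G R b * gramP G R b; P = gramP G R b; Q = gramQ G R b in
        blk H n 2 2 = - (\<Phi> * J0 G) \<and>
        opM G R b \<Phi> b + blk H n 2 1 * transpose_mat (bfC G)
          + blk Q n 2 1 * Bcat G * transpose_mat (bfD G)
          + J0 G * (transpose_mat (blk H n 1 2) * pB2 G + blk P n 2 1 * transpose_mat (pC0 G) * pD0 G)
              * J2 G * transpose_mat (bfI G)
          = 0\<^sub>m n (m2 + p)))"
proof -
  interpret plant_dims G n m1 m2 p p0
    using assms by unfold_locales
  show ?thesis
    using critical_point_iff[of b R] assms unfolding half_grad_b_def Let_def by blast
qed

end
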